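(* Let $\mu_1,\dots,\mu_N$ be absolutely continuous measures on $\mathbb{R}^n$, each with finite mass, with densities $g_1,\dots,g_N$. Let $\mu_\wedge$ be the absolutely continuous measure with density $g_\wedge:=\min_{1\le j\le N} g_j$, and fix some $m\ge 0$ satisfying $$\mathcal{M}(\mu_\wedge)\le m\le\min_{1\le j\le N}\mathcal{M}(\mu_j).$$ Then the multi-marginal optimal partial transport problem $$\min\left\{\int_{(\mathbb{R}^n)^N}\sum_{j\ne k}|x_j-x_k|^2\,\sigma'(dx_1,\dots,dx_N):\ \sigma'\in\Pi_{\le}(\mu_1,\dots,\mu_N),\ \mathcal{M}(\sigma')=m\right\}$$ has a unique solution.
   Context: "Measure" means positive Borel measure; every measure on $\mathbb{R}^n$ is assumed to have finite second moment. "Absolutely continuous" is with respect to Lebesgue measure. $\mathcal{M}(\mu)$ is the total mass of $\mu$. For measures, $\mu'\le\mu$ means $\mu'(E)\le\mu(E)$ for all measurable $E$. $\Pi_{\le}(\mu_1,\dots,\mu_N)$ is the set of measures on $(\mathbb{R}^n)^N$ whose $j$th marginal is $\le\mu_j$ for each $j$. *)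

theory Defs
  imports "HOL-Analysis.Analysis"
begin

definition total_mass :: "'a measure \<Rightarrow> ennreal" where
  "total_mass M = emeasure M (space M)"

definition finite_second_moment :: "(real ^ 'n) measure \<Rightarrow> bool" where
  "finite_second_moment M \<longleftrightarrow> (\<integral>\<^sup>+ x. ennreal ((norm x)\<^sup>2) \<partial>M) < \<infinity>"

(* (R^n)^N is the type (real ^ 'n) ^ 'k with CARD('n) = n and CARD('k) = N; its Borel
   sigma-algebra is the product sigma-algebra, and the j-th marginal is the
   push-forward under x \<mapsto> x $ j. *)
definition marginal :: "((real ^ 'n) ^ 'k) measure \<Rightarrow> 'k \<Rightarrow> (real ^ 'n) measure" where
  "marginal \<sigma> j = distr \<sigma> borel (\<lambda>x. x $ j)"

(* Domination is spelled out setwise: the library order on measures is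
   lexicographic in space, sets and emeasure. *)
definition partial_plans :: "('k \<Rightarrow> (real ^ 'n) measure) \<Rightarrow> ((real ^ 'n) ^ 'k) measure set" where
  "partial_plans \<mu> = {\<sigma>. sets \<sigma> = sets borel \<and>
     (\<forall>j. \<forall>E\<in>sets borel. emeasure (marginal \<sigma> j) E \<le> emeasure (\<mu> j) E)}"

(* The sum runs over ordered pairs, so each unordered pair is counted twice. *)
definition transport_cost :: "((real ^ 'n) ^ 'k) measure \<Rightarrow> ennreal" where
  "transport_cost \<sigma> =
     (\<integral>\<^sup>+ x. ennreal (\<Sum>(j, k)\<in>{(j, k). j \<noteq> k}. (norm (x $ j - x $ k))\<^sup>2) \<partial>\<sigma>)"

definition meet_measure :: "('k::finite \<Rightarrow> real ^ 'n \<Rightarrow> ennreal) \<Rightarrow> (real ^ 'n) measure" where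
  "meet_measure g = density lborel (\<lambda>x. Min (range (\<lambda>j. g j x)))"

end

theory Submission
  imports Defs "HOL-Probability.Probability"
begin

text \<open>
  Write \<open>S x = (\<Sum>j. x\<^sub>j)\<close>. Any two points \<open>x\<close>, \<open>x'\<close> of the support of an optimal plan satisfy
  \<open>\<bar>x'\<^sub>j - x\<^sub>j\<bar>\<^sup>2 \<le> (x'\<^sub>j - x\<^sub>j) \<bullet> (S x' - S x)\<close>, since swapping the \<open>j\<close>-th coordinates cannot lower
  the cost. So \<open>S x\<close> determines \<open>x\<close>, and \<open>S\<close> is a monotone function of \<open>x\<^sub>j\<close>, single-valued off a
  Lebesgue null set: almost surely each coordinate determines the whole point.
  Where \<open>\<mu>\<^sub>j\<close> has unused mass, \<open>x\<^sub>j\<close> may be moved freely, which forces \<open>S x = N x\<^sub>j\<close> almost everywhere.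

  Given two optimal plans, apply this to their average. If some regular point has unused mass in all
  of its coordinates, it lies on the diagonal and has cost 0, so the whole plan has cost 0 and lives
  on the diagonal; the mass constraint then makes both plans the diagonal image of \<open>\<mu>\<^sub>\<and>\<close>. Otherwise
  each regular point has a coordinate at which both plans exhaust \<open>\<mu>\<^sub>j\<close>, and they agree there.

  A minimiser exists because the second moments bound a minimising sequence, which therefore has an
  almost surely convergent realisation along a subsequence; Fatou's lemma does the rest.
\<close>

subsection \<open>Compactness of measures with bounded second moment\<close>

text \<open>The cost is 2N times the sum of the squared norms of the coordinates, minus twice the
  squared norm of S x, so coordinates interact only through S. A swap preserves the total of the
  first terms of both points, which leaves an inequality in S alone. The obstacle is that optimality
  speaks of measures, while the arguments compare points that may carry no mass.
  \<open>pair_cost_exchange\<close> is the bridge: it trades equal small masses between balls, with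
  product measures as competitors. Such points, like the points where a monotone relation is
  multivalued, split into countably many pieces that are each thin in some direction, and the cone
  criterion makes every piece null. The upper bound on m serves existence. The lower bound enters in
  the zero-cost case: the common marginal of a diagonal plan lies below every \<mu>_j, hence below
  their meet, and has at least the mass of the meet.\<close>

definition ternary :: "(nat \<Rightarrow> bool) \<Rightarrow> real" where
  "ternary b = (\<Sum>k. of_bool (b k) * (1/3)^k)"

lemma summable_ternary: "summable (\<lambda>k. of_bool (b k) * (1/3::real)^k)"
  by (rule summable_comparison_test'[of "\<lambda>k. (1/3::real)^k" 0]) (auto simp: summable_geometric)

lemma ternary_nonneg: "0 \<le> ternary b"
  unfolding ternary_def by (rule suminf_nonneg[OF summable_ternary]) simp

lemma ternary_le: "ternary b \<le> 3/2"
proof -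
  have "ternary b \<le> (\<Sum>k. (1/3::real)^k)"
    unfolding ternary_def
    by (rule suminf_le[OF _ summable_ternary]) (auto simp: summable_geometric)
  also have "\<dots> = 3/2" by (subst suminf_geometric) auto
  finally show ?thesis .
qed

lemma ternary_Suc: "ternary b = of_bool (b 0) + ternary (\<lambda>k. b (Suc k)) / 3"
proof -
  have "ternary b = of_bool (b 0) + (\<Sum>k. of_bool (b (Suc k)) * (1/3)^(Suc k))"
    unfolding ternary_def using suminf_split_head[OF summable_ternary, of b] by simp
  also have "(\<Sum>k. of_bool (b (Suc k)) * (1/3::real)^(Suc k))
      = (\<Sum>k. (1/3) * (of_bool (b (Suc k)) * (1/3)^k))"
    by (simp add: mult_ac)
  also have "\<dots> = (1/3) * ternary (\<lambda>k. b (Suc k))"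
    unfolding ternary_def by (rule suminf_mult[OF summable_ternary])
  finally show ?thesis by simp
qed

text \<open>The earlier digits contribute a multiple of 3 and the later ones a remainder in
  [0, 1/2]. This margin is the reason for base 3: with binary digits the remainder could reach 1 and
  a digit could not be read off reliably.\<close>

lemma ternary_shift:
  "\<exists>N::int. ternary b * 3^K = of_int (3 * N + of_bool (b K)) + ternary (\<lambda>k. b (Suc K + k)) / 3"
proof (induction K)
  case 0
  show ?case using ternary_Suc[of b] by (intro exI[of _ 0]) simp
next
  case (Suc K)
  then obtain N :: int where
    "ternary b * 3^K = of_int (3 * N + of_bool (b K)) + ternary (\<lambda>k. b (Suc K + k)) / 3" by blast
  then have "ternary b * 3^Suc K = 3 * of_int (3 * N + of_bool (b K)) + ternary (\<lambda>k. b (Suc K + k))"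
    by simp
  also have "ternary (\<lambda>k. b (Suc K + k)) = of_bool (b (Suc K)) + ternary (\<lambda>k. b (Suc (Suc K) + k)) / 3"
    using ternary_Suc[of "\<lambda>k. b (Suc K + k)"] by simp
  finally show ?case
    by (intro exI[of _ "3 * N + of_bool (b K)"]) simp
qed

lemma ternary_digit: "\<lfloor>ternary b * 3^K\<rfloor> mod 3 = of_bool (b K)"
proof -
  obtain N :: int where N:
    "ternary b * 3^K = of_int (3 * N + of_bool (b K)) + ternary (\<lambda>k. b (Suc K + k)) / 3"
    using ternary_shift by blast
  have "\<lfloor>ternary b * 3^K\<rfloor> = 3 * N + of_bool (b K)"
    unfolding N using ternary_nonneg ternary_le[of "\<lambda>k. b (Suc K + k)"]
    by (intro floor_unique) (auto simp: field_simps)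
  then show ?thesis by auto
qed

text \<open>Remainders in [0, 1/2] add at most 1/2 to the assumed distance, so the integer parts
  differ by less than 1 and coincide. Hence a convergent sequence of codes has every digit
  eventually constant.\<close>

lemma ternary_close:
  assumes "\<bar>ternary b - ternary b'\<bar> * 3^K < 1/2"
  shows "b K = b' K"
proof -
  obtain N :: int where N:
    "ternary b * 3^K = of_int (3 * N + of_bool (b K)) + ternary (\<lambda>k. b (Suc K + k)) / 3"
    using ternary_shift by blast
  obtain N' :: int where N':
    "ternary b' * 3^K = of_int (3 * N' + of_bool (b' K)) + ternary (\<lambda>k. b' (Suc K + k)) / 3"
    using ternary_shift by blast
  have "\<bar>ternary b * 3^K - ternary b' * 3^K\<bar> < 1/2"
    using assms by (simp add: left_diff_distrib[symmetric] abs_mult)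
  then have "\<bar>real_of_int (3 * N + of_bool (b K)) - real_of_int (3 * N' + of_bool (b' K))\<bar> < 1"
    using N N' ternary_nonneg[of "\<lambda>k. b (Suc K + k)"] ternary_le[of "\<lambda>k. b (Suc K + k)"]
      ternary_nonneg[of "\<lambda>k. b' (Suc K + k)"] ternary_le[of "\<lambda>k. b' (Suc K + k)"]
    by linarith
  then have "3 * N + of_bool (b K) = 3 * N' + (of_bool (b' K) :: int)" by linarith
  then show ?thesis by (cases "b K"; cases "b' K") (simp_all, presburger+)
qed

text \<open>Membership in the balls of a countable base is recorded in the ternary digits of a real number;
  this turns the theorems of Helly and Skorohod on the real line into statements about
  measures on a Euclidean space.\<close>

lemma euclidean_real_coding:
  obtains q :: "'a::euclidean_space \<Rightarrow> real" and p :: "real \<Rightarrow> 'a"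
  where "q \<in> borel_measurable borel" "p \<in> borel_measurable borel"
    "\<And>x. p (q x) = x" "\<And>x. 0 \<le> q x" "\<And>x. q x \<le> 3/2"
    "\<And>X t. (\<lambda>n. q (X n)) \<longlonglongrightarrow> t \<Longrightarrow> (\<exists>B. \<exists>\<^sub>F n in sequentially. norm (X n) \<le> B) \<Longrightarrow> convergent X"
proof -
  obtain D :: "'a set" where D: "countable D" "\<And>X. open X \<Longrightarrow> X \<noteq> {} \<Longrightarrow> \<exists>d\<in>D. d \<in> X"
    using countable_dense_setE by blast
  have "D \<noteq> {}" using D(2)[of UNIV] by auto
  define c where "c = from_nat_into D"
  have c: "\<exists>i. dist x (c i) < e" if "e > 0" for x e
  proof -
    from D(2)[of "ball x e"] that obtain d where "d \<in> D" "dist x d < e" by auto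
    then show ?thesis using from_nat_into_surj[OF D(1)] unfolding c_def by blast
  qed
  define ctr where "ctr k = c (fst (prod_decode k))" for k
  define rad where "rad k = 1 / real (Suc (snd (prod_decode k)))" for k
  define \<beta> where "\<beta> x k \<longleftrightarrow> dist x (ctr k) < rad k" for x k
  define q where "q x = ternary (\<beta> x)" for x
  have base: "\<exists>k. \<beta> x k \<and> rad k < e" if "e > 0" for x e
  proof -
    obtain m where m: "1 / real (Suc m) < e" using \<open>e > 0\<close> nat_approx_posE by blast
    obtain i where "dist x (c i) < 1 / real (Suc m)" using c[of "1 / real (Suc m)" x] by auto
    then show ?thesis
      using m by (intro exI[of _ "prod_encode (i, m)"]) (simp add: \<beta>_def ctr_def rad_def)
  qed
  have q_meas: "q \<in> borel_measurable borel"
    unfolding q_def ternary_def \<beta>_def by measurable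
  define digit where "digit k t \<longleftrightarrow> \<lfloor>t * 3^k\<rfloor> mod 3 = 1" for k and t :: real
  have digit_q: "digit k (q x) \<longleftrightarrow> \<beta> x k" for k x
    unfolding digit_def q_def by (simp add: ternary_digit)
  \<comment> \<open>Decoding follows the centres of ever smaller balls whose digit is set. On reals
    that are not codes the value is arbitrary, and only measurability matters there.\<close>
  define l where "l m t = (LEAST k. digit k t \<and> rad k < 1 / real (Suc m))" for m t
  define p where "p t = lim (\<lambda>m. ctr (l m t))" for t
  have digit_meas[measurable]: "Measurable.pred borel (digit k)" for k
    unfolding digit_def by measurable
  have l_meas[measurable]: "l m \<in> measurable borel (count_space UNIV)" for m
    unfolding l_def by measurable
  have p_meas: "p \<in> borel_measurable borel"
  proof -
    have "(\<lambda>t. ctr (l m t)) \<in> borel_measurable borel" for m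
      by (rule measurable_compose[OF l_meas]) simp
    then show ?thesis unfolding p_def by (rule borel_measurable_lim_metric)
  qed
  have pq: "p (q x) = x" for x
  proof -
    have *: "dist (ctr (l m (q x))) x < 1 / real (Suc m)" for m
    proof -
      have "\<exists>k. digit k (q x) \<and> rad k < 1 / real (Suc m)"
        using base[of "1 / real (Suc m)" x] by (auto simp: digit_q)
      then have "digit (l m (q x)) (q x) \<and> rad (l m (q x)) < 1 / real (Suc m)"
        unfolding l_def by (rule LeastI_ex)
      then show ?thesis by (auto simp: digit_q \<beta>_def dist_commute)
    qed
    have "(\<lambda>m. ctr (l m (q x))) \<longlonglongrightarrow> x"
    proof (subst tendsto_dist_iff, rule tendsto_sandwich[where f = "\<lambda>_. 0"])
      show "(\<lambda>m. 1 / real (Suc m)) \<longlonglongrightarrow> 0" by (rule LIMSEQ_Suc[OF lim_1_over_n])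
    qed (use * in \<open>auto intro!: always_eventually less_imp_le\<close>)
    then show ?thesis unfolding p_def by (rule limI)
  qed
  \<comment> \<open>Convergent codes alone do not suffice: for points escaping to infinity every
    digit is eventually 0. A bounded subsequence supplies a limit \<open>x\<close>; a small ball
    around \<open>x\<close> has an eventually constant digit, which traps the whole
    sequence.\<close>
  have conv: "convergent X"
    if lim: "(\<lambda>n. q (X n)) \<longlonglongrightarrow> t" and B: "\<exists>B. \<exists>\<^sub>F n in sequentially. norm (X n) \<le> B" for X t
  proof -
    obtain B where B: "\<exists>\<^sub>F n in sequentially. norm (X n) \<le> B" using B by blast
    have inf: "infinite {n. norm (X n) \<le> B}"
      using B by (simp add: frequently_cofinite[symmetric] cofinite_eq_sequentially)
    define s where "s = enumerate {n. norm (X n) \<le> B}"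
    have s: "strict_mono s" "\<And>i. norm (X (s i)) \<le> B"
      using strict_mono_enumerate[OF inf] enumerate_in_set[OF inf] by (auto simp: s_def)
    have "bounded (range (X \<circ> s))" using s(2) by (auto simp: bounded_iff)
    then obtain x r where xr: "strict_mono (r :: nat \<Rightarrow> nat)" "((X \<circ> s) \<circ> r) \<longlonglongrightarrow> x"
      using bounded_imp_convergent_subsequence by blast
    have "X \<longlonglongrightarrow> x"
    proof (rule metric_LIMSEQ_I)
      fix e :: real assume "e > 0"
      obtain k where k: "\<beta> x k" "rad k < e / 2" using base[of "e/2" x] \<open>e > 0\<close> by auto
      have "Cauchy (\<lambda>n. q (X n))" using lim by (rule LIMSEQ_imp_Cauchy)
      then obtain M where M: "\<And>m n. m \<ge> M \<Longrightarrow> n \<ge> M \<Longrightarrow> dist (q (X m)) (q (X n)) < 1 / (2 * 3^k)"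
        using metric_CauchyD[of "\<lambda>n. q (X n)" "1 / (2 * 3^k)"] by auto
      have same: "\<beta> (X m) k = \<beta> (X n) k" if "m \<ge> M" "n \<ge> M" for m n
        using M[OF that] by (intro ternary_close) (simp add: q_def dist_real_def field_simps)
      have "open (ball (ctr k) (rad k))" "x \<in> ball (ctr k) (rad k)"
        using k by (auto simp: \<beta>_def dist_commute)
      then have "\<forall>\<^sub>F i in sequentially. ((X \<circ> s) \<circ> r) i \<in> ball (ctr k) (rad k)"
        using xr(2) by (rule topological_tendstoD[rotated])
      then obtain i0 where i0: "\<And>i. i \<ge> i0 \<Longrightarrow> X (s (r i)) \<in> ball (ctr k) (rad k)"
        by (auto simp: eventually_sequentially)
      define i where "i = max i0 M"
      have "s (r i) \<ge> M"
        using seq_suble[OF s(1), of "r i"] seq_suble[OF xr(1), of i] by (simp add: i_def)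
      moreover have "\<beta> (X (s (r i))) k"
        using i0[of i] by (auto simp: \<beta>_def i_def dist_commute)
      ultimately have "\<beta> (X n) k" if "n \<ge> M" for n using same[OF that] by blast
      then have "dist (X n) x < e" if "n \<ge> M" for n
        using k(2) k(1)[unfolded \<beta>_def] that dist_triangle2[of "X n" x "ctr k"]
        by (fastforce simp: \<beta>_def)
      then show "\<exists>no. \<forall>n\<ge>no. dist (X n) x < e" by blast
    qed
    then show ?thesis by (auto simp: convergent_def)
  qed
  show ?thesis
    by (rule that[OF q_meas p_meas pq _ _ conv]) (simp_all only: q_def ternary_nonneg ternary_le)
qed

text \<open>Codes lie in a bounded interval, so tightness on the line is automatic and a convergent
  realisation of the codes exists. The moment bound excludes escape to infinity: by Fatou the lower
  limit of the squared norms is almost surely finite, which is the boundedness that the decoding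
  requires.\<close>

lemma skorohod_subsequence:
  fixes P :: "nat \<Rightarrow> 'a::euclidean_space measure" and C :: ennreal
  assumes prob: "\<And>n. prob_space (P n)" and sets_P: "\<And>n. sets (P n) = sets borel"
    and moment: "\<And>n. (\<integral>\<^sup>+ x. ennreal ((norm x)\<^sup>2) \<partial>P n) \<le> C" and C: "C < \<infinity>"
  obtains r :: "nat \<Rightarrow> nat" and \<Omega> :: "real measure" and Y X
  where "strict_mono r" "prob_space \<Omega>"
    "\<And>n. Y n \<in> borel_measurable \<Omega>" "\<And>n. distr \<Omega> borel (Y n) = P (r n)"
    "X \<in> borel_measurable \<Omega>" "AE \<omega> in \<Omega>. (\<lambda>n. Y n \<omega>) \<longlonglongrightarrow> X \<omega>"
proof -
  obtain q :: "'a \<Rightarrow> real" and p where [measurable]: "q \<in> borel_measurable borel" "p \<in> borel_measurable borel"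
    and pq: "\<And>x. p (q x) = x" and q_bd: "\<And>x. 0 \<le> q x" "\<And>x. q x \<le> 3/2"
    and conv: "\<And>X t. (\<lambda>n. q (X n)) \<longlonglongrightarrow> t \<Longrightarrow> (\<exists>B. \<exists>\<^sub>F n in sequentially. norm (X n) \<le> B) \<Longrightarrow> convergent X"
    by (rule euclidean_real_coding) (rule that; assumption)
  have [measurable_cong]: "sets (P n) = sets borel" for n by (rule sets_P)
  define \<nu> where "\<nu> n = distr (P n) borel q" for n
  have \<nu>: "real_distribution (\<nu> n)" for n
    unfolding \<nu>_def real_distribution_def real_distribution_axioms_def
    by (auto intro!: prob_space.prob_space_distr[OF prob])
  have "tight \<nu>"
    unfolding tight_def
  proof (safe intro!: \<nu>)
    fix \<epsilon> :: real assume "\<epsilon> > 0"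
    \<comment> \<open>Tightness is stated with half-open intervals, so the left end must lie
      strictly below the possible code 0.\<close>
    have q_bd': "-1 < q x" "q x \<le> 2" for x using q_bd[of x] by linarith+
    have "measure (\<nu> n) {-1<..2} = 1" for n
    proof -
      have "measure (\<nu> n) {-1<..2} = measure (P n) (q -` {-1<..2} \<inter> space (P n))"
        unfolding \<nu>_def by (rule measure_distr) auto
      also have "q -` {-1<..2} \<inter> space (P n) = space (P n)"
        using q_bd' by auto
      finally show ?thesis using prob_space.prob_space[OF prob] by simp
    qed
    then show "\<exists>a b. a < b \<and> (\<forall>n. 1 - \<epsilon> < measure (\<nu> n) {a<..b})"
      using \<open>\<epsilon> > 0\<close> by (intro exI[of _ "-1"] exI[of _ 2]) auto
  qed
  then obtain r M where r: "strict_mono (r :: nat \<Rightarrow> nat)" and M: "real_distribution M"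
    "weak_conv_m (\<nu> \<circ> id \<circ> r) M"
    using tight_imp_convergent_subsubsequence[of \<nu> id] by (auto simp: strict_mono_id)
  obtain \<Omega> :: "real measure" and Z Z' where \<Omega>: "prob_space \<Omega>"
    and [measurable]: "\<And>n. Z n \<in> borel_measurable \<Omega>"
    and Z: "\<And>n. distr \<Omega> borel (Z n) = \<nu> (r n)"
    and ZZ': "\<And>\<omega>. \<omega> \<in> space \<Omega> \<Longrightarrow> (\<lambda>n. Z n \<omega>) \<longlonglongrightarrow> Z' \<omega>"
  proof -
    have "\<exists>(\<Omega> :: real measure) (Z :: nat \<Rightarrow> real \<Rightarrow> real) (Z' :: real \<Rightarrow> real). prob_space \<Omega> \<and>
        (\<forall>n. Z n \<in> measurable \<Omega> borel) \<and> (\<forall>n. distr \<Omega> borel (Z n) = (\<nu> \<circ> id \<circ> r) n) \<and>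
        Z' \<in> measurable \<Omega> lborel \<and> distr \<Omega> borel Z' = M \<and>
        (\<forall>\<omega>\<in>space \<Omega>. (\<lambda>n. Z n \<omega>) \<longlonglongrightarrow> Z' \<omega>)"
      by (rule Skorohod) (use \<nu> M in \<open>simp_all add: comp_def\<close>)
    then show thesis
    proof (elim exE, goal_cases)
      case (1 \<Omega> Z Z')
      then show thesis by (intro that[of \<Omega> Z Z']) auto
    qed
  qed
  define Y where "Y n \<omega> = p (Z n \<omega>)" for n \<omega>
  \<comment> \<open>The limit is taken among decoded points, not by decoding \<open>Z'\<close>: a
    limit of codes need not be a code.\<close>
  define X where "X \<omega> = lim (\<lambda>n. Y n \<omega>)" for \<omega>
  have Y_meas[measurable]: "Y n \<in> borel_measurable \<Omega>" for n
    unfolding Y_def by measurable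
  have X_meas: "X \<in> borel_measurable \<Omega>"
    unfolding X_def by measurable
  have distr_Y: "distr \<Omega> borel (Y n) = P (r n)" for n
  proof -
    have "distr \<Omega> borel (Y n) = distr (distr \<Omega> borel (Z n)) borel p"
      by (subst distr_distr) (auto simp: Y_def[abs_def] comp_def)
    also have "\<dots> = distr (P (r n)) borel (p \<circ> q)"
      unfolding Z \<nu>_def by (subst distr_distr) auto
    also have "p \<circ> q = (\<lambda>x. x)" using pq by auto
    also have "distr (P (r n)) borel (\<lambda>x. x) = P (r n)"
      by (rule distr_id2) (simp add: sets_P)
    finally show ?thesis .
  qed
  \<comment> \<open>Almost surely \<open>Z n\<close> is a genuine code, since its law is a
    push-forward under \<open>q\<close>.\<close>
  have "AE \<omega> in \<Omega>. q (Y n \<omega>) = Z n \<omega>" for n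
  proof -
    have "AE x in P (r n). q (p (q x)) = q x" by (simp add: pq)
    then have "AE t in \<nu> (r n). q (p t) = t"
      unfolding \<nu>_def by (subst AE_distr_iff) auto
    then show ?thesis
      unfolding Z[symmetric] by (subst (asm) AE_distr_iff) (auto simp: Y_def)
  qed
  then have qY: "AE \<omega> in \<Omega>. \<forall>n. q (Y n \<omega>) = Z n \<omega>" by (simp add: AE_all_countable)
  have "(\<integral>\<^sup>+ \<omega>. liminf (\<lambda>n. ennreal ((norm (Y n \<omega>))\<^sup>2)) \<partial>\<Omega>)
      \<le> liminf (\<lambda>n. \<integral>\<^sup>+ \<omega>. ennreal ((norm (Y n \<omega>))\<^sup>2) \<partial>\<Omega>)"
    by (rule nn_integral_liminf) measurable
  also have "\<dots> = liminf (\<lambda>n. \<integral>\<^sup>+ x. ennreal ((norm x)\<^sup>2) \<partial>P (r n))"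
    unfolding distr_Y[symmetric] by (subst nn_integral_distr) auto
  also have "\<dots> \<le> liminf (\<lambda>n. C)"
    using moment by (intro Liminf_mono) (auto intro!: always_eventually)
  also have "\<dots> < \<infinity>" using C by (simp add: Liminf_const)
  finally have "AE \<omega> in \<Omega>. liminf (\<lambda>n. ennreal ((norm (Y n \<omega>))\<^sup>2)) \<noteq> \<infinity>"
    by (intro nn_integral_noteq_infinite) auto
  with qY AE_space[of \<Omega>] have "AE \<omega> in \<Omega>. (\<lambda>n. Y n \<omega>) \<longlonglongrightarrow> X \<omega>"
  proof (eventually_elim, goal_cases)
    case (1 \<omega>)
    have "\<exists>B. \<exists>\<^sub>F n in sequentially. norm (Y n \<omega>) \<le> B"
    proof (rule ccontr)
      assume "\<nexists>B. \<exists>\<^sub>F n in sequentially. norm (Y n \<omega>) \<le> B"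
      then have ev: "\<forall>\<^sub>F n in sequentially. B < norm (Y n \<omega>)" for B
        by (simp add: not_frequently not_le)
      obtain L where L: "0 \<le> L" "liminf (\<lambda>n. ennreal ((norm (Y n \<omega>))\<^sup>2)) = ennreal L"
        using 1(3) by (cases "liminf (\<lambda>n. ennreal ((norm (Y n \<omega>))\<^sup>2))") auto
      have "ennreal (L + 1) \<le> liminf (\<lambda>n. ennreal ((norm (Y n \<omega>))\<^sup>2))"
      proof (rule Liminf_bounded)
        show "\<forall>\<^sub>F n in sequentially. ennreal (L + 1) \<le> ennreal ((norm (Y n \<omega>))\<^sup>2)"
          using ev[of "L + 1"]
        proof eventually_elim
          case (elim n)
          have "L + 1 \<le> (L + 1)\<^sup>2" using L(1) by (simp add: power2_eq_square algebra_simps)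
          also have "\<dots> \<le> (norm (Y n \<omega>))\<^sup>2" using elim L(1) by (intro power_mono) auto
          finally show ?case by (rule ennreal_leI)
        qed
      qed
      then show False using L by (simp add: ennreal_le_iff)
    qed
    moreover have "(\<lambda>n. q (Y n \<omega>)) \<longlonglongrightarrow> Z' \<omega>" using ZZ'[OF 1(2)] 1(1) by simp
    ultimately have "convergent (\<lambda>n. Y n \<omega>)" by (intro conv)
    then show ?case unfolding X_def by (simp add: convergent_LIMSEQ_iff)
  qed
  then show ?thesis
    using that[OF r \<Omega> Y_meas distr_Y X_meas] by blast
qed

subsection \<open>Null sets\<close>

text \<open>The orthogonal projection along \<open>e\<close> is injective on such a set, with a Lipschitz inverse,
  and its image lies in a hyperplane.\<close>

lemma negligible_cone_condition:
  fixes Q :: "'a::euclidean_space set"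
  assumes e: "e \<noteq> 0"
    and Q: "\<And>x y. x \<in> Q \<Longrightarrow> y \<in> Q \<Longrightarrow> \<bar>(x - y) \<bullet> e\<bar> \<le> norm (x - y) * norm e / 2"
  shows "negligible Q"
proof -
  define pr where "pr x = x - ((x \<bullet> e) / (e \<bullet> e)) *\<^sub>R e" for x
  have ee: "e \<bullet> e > 0" using e by simp
  have pr_diff: "pr x - pr y = pr (x - y)" for x y
    by (simp add: pr_def inner_diff_left diff_divide_distrib scaleR_left_diff_distrib)
  have pr_norm: "(norm (pr d))\<^sup>2 = (norm d)\<^sup>2 - (d \<bullet> e)\<^sup>2 / (norm e)\<^sup>2" for d
    using ee unfolding power2_norm_eq_inner pr_def
    by (simp add: inner_diff_left inner_diff_right inner_commute field_simps power2_eq_square)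
  \<comment> \<open>By Pythagoras the projection keeps at least 3/4 of the squared length of a
    difference, so the constant 2 is generous.\<close>
  have lip: "norm (x - y) \<le> 2 * norm (pr x - pr y)" if "x \<in> Q" "y \<in> Q" for x y
  proof (rule power2_le_imp_le)
    let ?d = "x - y"
    have "(?d \<bullet> e)\<^sup>2 \<le> (norm ?d * norm e / 2)\<^sup>2"
      using Q[OF that] by (simp add: abs_le_square_iff[symmetric])
    then have "(?d \<bullet> e)\<^sup>2 / (norm e)\<^sup>2 \<le> (norm ?d)\<^sup>2 / 4"
      using e by (simp add: field_simps power_mult_distrib)
    moreover have "(2 * norm (pr x - pr y))\<^sup>2 = 4 * ((norm ?d)\<^sup>2 - (?d \<bullet> e)\<^sup>2 / (norm e)\<^sup>2)"
      by (simp add: pr_diff power_mult_distrib pr_norm)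
    ultimately show "(norm ?d)\<^sup>2 \<le> (2 * norm (pr x - pr y))\<^sup>2"
      using zero_le_power2[of "norm ?d"] by argo
  qed simp
  have inj: "inj_on pr Q" using lip by (intro inj_onI) force
  have "negligible (pr ` Q)"
  proof (rule negligible_subset)
    show "negligible {x. e \<bullet> x = 0}" by (rule negligible_hyperplane) (simp add: e)
    show "pr ` Q \<subseteq> {x. e \<bullet> x = 0}"
      using ee by (auto simp: pr_def inner_diff_right inner_commute)
  qed
  then have "negligible (the_inv_into Q pr ` (pr ` Q))"
  proof (rule negligible_locally_Lipschitz_image[OF order_refl])
    fix x assume "x \<in> pr ` Q"
    show "\<exists>T B. open T \<and> x \<in> T \<and> (\<forall>y\<in>pr ` Q \<inter> T.
        norm (the_inv_into Q pr y - the_inv_into Q pr x) \<le> B * norm (y - x))"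
      using \<open>x \<in> pr ` Q\<close> lip by (intro exI[of _ UNIV] exI[of _ 2]) (auto simp: the_inv_into_f_f[OF inj])
  qed
  moreover have "the_inv_into Q pr ` (pr ` Q) = Q"
    by (force simp: the_inv_into_f_f[OF inj] image_image)
  ultimately show ?thesis by simp
qed

text \<open>Fix a and b in a countable dense set and collect the points with one value near a and
  another near b. Monotonicity applied crosswise, a value near a at one point against a value near b
  at the other, bounds (x - y) \<bullet> (b - a) on both sides. The two errors of a quarter each
  give the factor 1/2 of the cone condition.\<close>

lemma negligible_monotone_multivalued:
  fixes M :: "('a::euclidean_space \<times> 'a) set"
  assumes mono: "\<And>x s y t. (x, s) \<in> M \<Longrightarrow> (y, t) \<in> M \<Longrightarrow> 0 \<le> (x - y) \<bullet> (s - t)"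
  shows "negligible {x. \<exists>s t. (x, s) \<in> M \<and> (x, t) \<in> M \<and> s \<noteq> t}"
proof -
  obtain D :: "'a set" where D: "countable D" "\<And>X. open X \<Longrightarrow> X \<noteq> {} \<Longrightarrow> \<exists>d\<in>D. d \<in> X"
    using countable_dense_setE by blast
  define Q where "Q a b = {x. \<exists>s t. (x, s) \<in> M \<and> (x, t) \<in> M \<and>
      dist s a < dist a b / 4 \<and> dist t b < dist a b / 4}" for a b
  have Q: "negligible (Q a b)" if "a \<noteq> b" for a b
  proof (rule negligible_cone_condition)
    show "b - a \<noteq> 0" using that by simp
    fix x y assume "x \<in> Q a b" "y \<in> Q a b"
    then obtain s t s' t' where st: "(x, s) \<in> M" "(x, t) \<in> M" "(y, s') \<in> M" "(y, t') \<in> M"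
      "dist s a < dist a b / 4" "dist t b < dist a b / 4"
      "dist s' a < dist a b / 4" "dist t' b < dist a b / 4"
      unfolding Q_def by blast
    have cs: "\<bar>(x - y) \<bullet> u\<bar> \<le> norm (x - y) * (dist a b / 4)" if "norm u < dist a b / 4" for u
      using Cauchy_Schwarz_ineq2[of "x - y" u] that
      by (meson less_imp_le mult_left_mono norm_ge_zero order_trans)
    have "0 \<le> (x - y) \<bullet> (s - t')" "0 \<le> (x - y) \<bullet> (t - s')"
      using mono st by auto
    moreover have "(x - y) \<bullet> (s - t') = (x - y) \<bullet> (s - a) - (x - y) \<bullet> (t' - b) - (x - y) \<bullet> (b - a)"
      "(x - y) \<bullet> (t - s') = (x - y) \<bullet> (t - b) - (x - y) \<bullet> (s' - a) + (x - y) \<bullet> (b - a)"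
      by (simp_all add: inner_diff_right)
    moreover have "\<bar>(x - y) \<bullet> (s - a)\<bar> \<le> norm (x - y) * (dist a b / 4)"
      "\<bar>(x - y) \<bullet> (t' - b)\<bar> \<le> norm (x - y) * (dist a b / 4)"
      "\<bar>(x - y) \<bullet> (t - b)\<bar> \<le> norm (x - y) * (dist a b / 4)"
      "\<bar>(x - y) \<bullet> (s' - a)\<bar> \<le> norm (x - y) * (dist a b / 4)"
      by (rule cs; use st in \<open>simp add: dist_norm\<close>)+
    ultimately have "\<bar>(x - y) \<bullet> (b - a)\<bar> \<le> 2 * (norm (x - y) * (dist a b / 4))"
      unfolding abs_le_iff by linarith
    then show "\<bar>(x - y) \<bullet> (b - a)\<bar> \<le> norm (x - y) * norm (b - a) / 2"
      by (simp add: dist_norm norm_minus_commute mult.commute)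
  qed
  have "negligible (\<Union>(a, b)\<in>{(a, b) \<in> D \<times> D. a \<noteq> b}. Q a b)"
  proof (rule negligible_countable_Union)
    show "countable ((\<lambda>(a, b). Q a b) ` {(a, b) \<in> D \<times> D. a \<noteq> b})"
      by (intro countable_image countable_subset[OF _ countable_SIGMA[OF D(1) D(1)]]) auto
  qed (use Q in auto)
  moreover have "{x. \<exists>s t. (x, s) \<in> M \<and> (x, t) \<in> M \<and> s \<noteq> t} \<subseteq>
      (\<Union>(a, b)\<in>{(a, b) \<in> D \<times> D. a \<noteq> b}. Q a b)"
  proof safe
    fix x s t assume st: "(x, s) \<in> M" "(x, t) \<in> M" "s \<noteq> t"
    obtain a where a: "a \<in> D" "dist s a < dist s t / 12"
      using D(2)[of "ball s (dist s t / 12)"] st(3) by auto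
    obtain b where b: "b \<in> D" "dist t b < dist s t / 12"
      using D(2)[of "ball t (dist s t / 12)"] st(3) by auto
    \<comment> \<open>With errors below 1/12 of \<open>dist s t\<close>, at least 10/12 of it
      remains for \<open>dist a b\<close>, and 1/12 is less than a quarter of 10/12.\<close>
    have "dist s t \<le> dist s a + dist a b + dist t b"
      using dist_triangle[of s t a] dist_triangle[of a t b] by (simp add: dist_commute)
    then have ab: "dist s t * (10/12) \<le> dist a b" using a b by simp
    moreover have "0 < dist s t" using st(3) by simp
    ultimately have close: "dist s a < dist a b / 4" "dist t b < dist a b / 4" and "0 < dist a b"
      using a(2) b(2) by linarith+
    then have "a \<noteq> b" by auto
    then show "x \<in> (\<Union>(a, b)\<in>{(a, b) \<in> D \<times> D. a \<noteq> b}. Q a b)"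
      using a b st close by (auto simp: Q_def)
  qed
  ultimately show ?thesis by (rule negligible_subset)
qed

text \<open>For C > 0 the condition says that the open ball with centre x + w/(2C) and x on its
  boundary misses \<open>Z\<close>. Among points that are close together and have nearly equal
  directions w, each lies in \<open>Z\<close> as seen from the other. The quadratic term is then at
  most a quarter of |y - x| |e|, replacing w by e costs another quarter, and exchanging the two
  points gives the two-sided cone condition.\<close>

lemma negligible_exterior_ball_points:
  fixes Z :: "'a::euclidean_space set"
  shows "negligible {x \<in> Z. \<exists>w. w \<noteq> 0 \<and> (\<forall>z\<in>Z. (z - x) \<bullet> w \<le> C * (norm (z - x))\<^sup>2)}"
proof -
  obtain D :: "'a set" where D: "countable D" "\<And>X. open X \<Longrightarrow> X \<noteq> {} \<Longrightarrow> \<exists>d\<in>D. d \<in> X"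
    using countable_dense_setE by blast
  \<comment> \<open>A positive bound for \<open>C\<close>, whatever its sign, so that the
    localisation radius |e| / (8 K) makes sense.\<close>
  define K where "K = \<bar>C\<bar> + 1"
  define Q where "Q e a = {x \<in> Z. dist x a * (8 * K) < norm e \<and>
      (\<exists>w. dist w e < norm e / 4 \<and> (\<forall>z\<in>Z. (z - x) \<bullet> w \<le> C * (norm (z - x))\<^sup>2))}" for e a
  have K: "K \<ge> 1" "C \<le> K" unfolding K_def by auto
  have Q: "negligible (Q e a)" if "e \<noteq> 0" for e a
  proof (rule negligible_cone_condition)
    show "e \<noteq> 0" by fact
    have *: "(y - x) \<bullet> e \<le> norm (y - x) * norm e / 2" if x: "x \<in> Q e a" and y: "y \<in> Q e a" for x y
    proof -
      obtain w where w: "dist w e < norm e / 4" "(y - x) \<bullet> w \<le> C * (norm (y - x))\<^sup>2"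
        using x y unfolding Q_def by blast
      have "dist x a * K < norm e / 8" "dist y a * K < norm e / 8" using x y by (auto simp: Q_def)
      then have "(dist x a + dist y a) * K < norm e / 4" by (simp add: algebra_simps)
      moreover have "norm (y - x) \<le> dist x a + dist y a"
        by (metis add.commute dist_norm dist_triangle2)
      then have "norm (y - x) * K \<le> (dist x a + dist y a) * K"
        using K by (intro mult_right_mono) auto
      ultimately have "norm (y - x) * (norm (y - x) * K) \<le> norm (y - x) * (norm e / 4)"
        by (intro mult_left_mono) auto
      moreover have "C * (norm (y - x))\<^sup>2 \<le> norm (y - x) * (norm (y - x) * K)"
        using mult_right_mono[OF K(2), of "(norm (y - x))\<^sup>2"]
        by (simp add: power2_eq_square mult_ac)
      moreover have "(y - x) \<bullet> (e - w) \<le> norm (y - x) * (norm e / 4)"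
        using norm_cauchy_schwarz[of "y - x" "e - w"]
          mult_left_mono[of "norm (e - w)" "norm e / 4" "norm (y - x)"] w(1)
        by (simp add: dist_norm norm_minus_commute)
      moreover have "(y - x) \<bullet> e = (y - x) \<bullet> w + (y - x) \<bullet> (e - w)"
        by (simp add: inner_diff_right)
      ultimately show ?thesis using w(2) by simp
    qed
    fix x y assume xy: "x \<in> Q e a" "y \<in> Q e a"
    have "(x - y) \<bullet> e = - ((y - x) \<bullet> e)" by (metis inner_minus_left minus_diff_eq)
    then show "\<bar>(x - y) \<bullet> e\<bar> \<le> norm (x - y) * norm e / 2"
      using *[OF xy] *[OF xy(2,1)] by (simp add: norm_minus_commute abs_le_iff)
  qed
  have "negligible (\<Union>(e, a)\<in>{(e, a) \<in> D \<times> D. e \<noteq> 0}. Q e a)"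
  proof (rule negligible_countable_Union)
    show "countable ((\<lambda>(a, b). Q a b) ` {(e, a) \<in> D \<times> D. e \<noteq> 0})"
      by (intro countable_image countable_subset[OF _ countable_SIGMA[OF D(1) D(1)]]) auto
  qed (use Q in auto)
  moreover have "{x \<in> Z. \<exists>w. w \<noteq> 0 \<and> (\<forall>z\<in>Z. (z - x) \<bullet> w \<le> C * (norm (z - x))\<^sup>2)} \<subseteq>
      (\<Union>(e, a)\<in>{(e, a) \<in> D \<times> D. e \<noteq> 0}. Q e a)"
  proof safe
    fix x w assume x: "x \<in> Z" and w: "w \<noteq> 0" "\<forall>z\<in>Z. (z - x) \<bullet> w \<le> C * (norm (z - x))\<^sup>2"
    \<comment> \<open>An error of |w|/5 leaves |e| at least 4|w|/5, so the error is below |e|/4 as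
      \<open>Q\<close> demands.\<close>
    obtain e where e: "e \<in> D" "dist w e < norm w / 5"
      using D(2)[of "ball w (norm w / 5)"] w(1) by auto
    have "norm w \<le> norm e + dist w e" by (metis dist_norm norm_triangle_sub)
    then have *: "norm w * 4 \<le> 5 * norm e" using e by simp
    have "0 < norm w" using w(1) by simp
    with * have "norm e > 0" by linarith
    then have e': "e \<noteq> 0" by auto
    have dwe: "dist w e < norm e / 4" using * e(2) by linarith
    have "0 < norm e / (8 * K)" using e' K by (intro divide_pos_pos) auto
    then obtain a where a: "a \<in> D" "dist x a < norm e / (8 * K)"
      using D(2)[of "ball x (norm e / (8 * K))"] by auto
    then have "dist x a * (8 * K) < norm e" using K by (simp add: field_simps)
    then have "x \<in> Q e a" using x w dwe unfolding Q_def by blast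
    then show "x \<in> (\<Union>(e, a)\<in>{(e, a) \<in> D \<times> D. e \<noteq> 0}. Q e a)" using e e' a by auto
  qed
  ultimately show ?thesis by (rule negligible_subset)
qed

subsection \<open>Sums, supports and products of measures\<close>

definition add_measure :: "'a measure \<Rightarrow> 'a measure \<Rightarrow> 'a measure" where
  "add_measure M N = measure_of (space M) (sets M) (\<lambda>A. emeasure M A + emeasure N A)"

lemma space_add_measure [simp]: "space (add_measure M N) = space M"
  and sets_add_measure [simp, measurable_cong]: "sets (add_measure M N) = sets M"
  by (auto simp: add_measure_def)

lemma emeasure_add_measure:
  assumes "sets M = sets N" "A \<in> sets M"
  shows "emeasure (add_measure M N) A = emeasure M A + emeasure N A"
  unfolding add_measure_def
proof (rule emeasure_measure_of_sigma[OF sets.sigma_algebra_axioms _ _ assms(2)])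
  show "positive (sets M) (\<lambda>A. emeasure M A + emeasure N A)" by (simp add: positive_def)
  show "countably_additive (sets M) (\<lambda>A. emeasure M A + emeasure N A)"
    unfolding countably_additive_def using assms(1)
    by (simp add: suminf_emeasure suminf_add[symmetric])
qed

lemma nn_integral_add_measure:
  assumes "sets M = sets N" "f \<in> borel_measurable M"
  shows "(\<integral>\<^sup>+ x. f x \<partial>add_measure M N) = (\<integral>\<^sup>+ x. f x \<partial>M) + (\<integral>\<^sup>+ x. f x \<partial>N)"
proof -
  have meas: "h \<in> borel_measurable N" if "h \<in> borel_measurable M" for h :: "'a \<Rightarrow> ennreal"
    using that by (simp cong: measurable_cong_sets add: assms(1))
  show ?thesis using assms(2)
  proof (induction f rule: borel_measurable_induct)
    case (cong f g)
    have "(\<integral>\<^sup>+ x. f x \<partial>L) = (\<integral>\<^sup>+ x. g x \<partial>L)" if "space L = space M" for L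
      using cong(3) that by (intro nn_integral_cong) auto
    with cong(4) show ?case
      by (simp add: sets_eq_imp_space_eq[OF assms(1)])
  next
    case (set A)
    then show ?case using assms(1) by (simp add: emeasure_add_measure)
  next
    case (mult u c)
    then show ?case by (simp add: nn_integral_cmult distrib_left meas)
  next
    case (add u v)
    then show ?case by (simp add: nn_integral_add ac_simps meas)
  next
    case (seq U)
    have inc: "incseq (\<lambda>i. \<integral>\<^sup>+ x. U i x \<partial>L)" for L
      using seq(3) by (auto simp: incseq_def le_fun_def intro!: nn_integral_mono)
    show ?case
      using seq
      by (simp add: meas nn_integral_monotone_convergence_SUP image_comp ennreal_SUP_add[OF inc inc] SUP_apply)
  qed
qed

section \<open>Topological supports\<close>

definition measure_support :: "'a::metric_space measure \<Rightarrow> 'a set" where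
  "measure_support M = {x. \<forall>r>0. 0 < emeasure M (ball x r)}"

lemma closed_measure_support:
  assumes "sets M = sets borel"
  shows "closed (measure_support M)"
proof -
  have "\<exists>r>0. ball x r \<subseteq> - measure_support M" if x: "x \<notin> measure_support M" for x
  proof -
    obtain r where r: "r > 0" "emeasure M (ball x r) = 0"
      using x by (auto simp: measure_support_def)
    have "y \<notin> measure_support M" if "y \<in> ball x r" for y
    proof -
      have "ball y (r - dist x y) \<subseteq> ball x r"
      proof
        fix z assume "z \<in> ball y (r - dist x y)"
        then show "z \<in> ball x r" using dist_triangle[of x z y] by simp
      qed
      then have "emeasure M (ball y (r - dist x y)) \<le> emeasure M (ball x r)"
        by (intro emeasure_mono) (auto simp: assms)
      then show ?thesis using r(2) that
        by (auto simp: measure_support_def intro!: exI[of _ "r - dist x y"])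
    qed
    then show ?thesis using r(1) by blast
  qed
  then show ?thesis unfolding closed_def open_contains_ball by auto
qed

text \<open>The complement is a union of null balls; by second countability (Lindelof) countably
  many of them cover it.\<close>

lemma AE_measure_support:
  fixes M :: "'a::{metric_space, second_countable_topology} measure"
  assumes M: "sets M = sets borel"
  shows "AE x in M. x \<in> measure_support M"
proof -
  define F where "F = {ball x r | x r. emeasure M (ball x r) = (0::ennreal) \<and> (r::real) > 0}"
  obtain F' where F': "F' \<subseteq> F" "countable F'" "\<Union>F' = \<Union>F"
    by (rule Lindelof[of F]) (auto simp: F_def)
  have "\<Union>F' \<in> null_sets M"
  proof -
    have "i \<in> null_sets M" if "i \<in> F'" for i
      using F'(1) that by (intro null_setsI) (auto simp: F_def M)
    then show ?thesis using null_sets_UN'[OF F'(2), of id] by simp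
  qed
  moreover have "- measure_support M \<subseteq> \<Union>F"
    by (force simp: F_def measure_support_def)
  ultimately show ?thesis
    by (intro AE_I'[of "\<Union>F'"]) (auto simp: F'(3))
qed

lemma borel_measurable_vec_nth [measurable]: "(\<lambda>x. x $ j) \<in> borel_measurable borel"
  by (intro borel_measurable_continuous_onI continuous_intros)

section \<open>Product measures on vectors\<close>

text \<open>Serves as a coupling of prescribed marginals. Independence is immaterial: what is used
  is that the marginals are as prescribed, so that marginals concentrated near given points force
  the vector near the corresponding point.\<close>

definition vec_measure :: "('k::finite \<Rightarrow> 'a measure) \<Rightarrow> ('a::euclidean_space ^ 'k) measure" where
  "vec_measure \<alpha> = distr (PiM UNIV \<alpha>) borel vec_lambda"

context
  fixes \<alpha> :: "'k::finite \<Rightarrow> 'a::euclidean_space measure"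
  assumes prob: "\<And>j. prob_space (\<alpha> j)" and sets_\<alpha>: "\<And>j. sets (\<alpha> j) = sets borel"
begin

lemma measurable_vec_lambda: "vec_lambda \<in> borel_measurable (PiM UNIV \<alpha>)"
proof (subst borel_measurable_euclidean_space, safe)
  fix i :: "'a ^ 'k" assume "i \<in> Basis"
  then obtain j b where i: "i = axis j b" "b \<in> Basis" by (auto simp: Basis_vec_def)
  have "(\<lambda>f. f j) \<in> borel_measurable (PiM UNIV \<alpha>)"
    using measurable_component_singleton[of j UNIV \<alpha>]
    by (simp cong: measurable_cong_sets add: sets_\<alpha>)
  then show "(\<lambda>f. vec_lambda f \<bullet> i) \<in> borel_measurable (PiM UNIV \<alpha>)"
    by (simp add: i inner_axis)
qed

lemma sets_vec_measure [simp]: "sets (vec_measure \<alpha>) = sets borel"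
  by (simp add: vec_measure_def)

lemma prob_space_vec_measure: "prob_space (vec_measure \<alpha>)"
  unfolding vec_measure_def
  by (intro prob_space.prob_space_distr prob_space_PiM prob measurable_vec_lambda)

lemma distr_vec_measure: "distr (vec_measure \<alpha>) borel (\<lambda>x. x $ j) = \<alpha> j"
proof -
  have "distr (vec_measure \<alpha>) borel (\<lambda>x. x $ j) = distr (PiM UNIV \<alpha>) borel (\<lambda>f. f j)"
    unfolding vec_measure_def
    by (subst distr_distr[OF _ measurable_vec_lambda]) (auto simp: comp_def)
  also have "\<dots> = distr (PiM UNIV \<alpha>) (\<alpha> j) (\<lambda>f. f j)"
    by (rule distr_cong) (auto simp: sets_\<alpha>)
  also have "\<dots> = \<alpha> j" using prob by (intro distr_PiM_component) auto
  finally show ?thesis .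
qed

end

subsection \<open>The cost and the feasible plans\<close>

definition pair_cost :: "(real ^ 'n) ^ 'k \<Rightarrow> real" where
  "pair_cost x = (\<Sum>(j, k)\<in>{(j, k). j \<noteq> k}. (norm (x $ j - x $ k))\<^sup>2)"

lemma transport_cost_eq: "transport_cost \<sigma> = (\<integral>\<^sup>+ x. ennreal (pair_cost x) \<partial>\<sigma>)"
  by (simp add: transport_cost_def pair_cost_def)

lemma pair_cost_nonneg: "0 \<le> pair_cost x"
  unfolding pair_cost_def by (intro sum_nonneg) auto

lemma continuous_on_pair_cost: "continuous_on S pair_cost"
  unfolding pair_cost_def case_prod_beta by (intro continuous_intros)

lemma borel_measurable_pair_cost [measurable]: "pair_cost \<in> borel_measurable borel"
  by (intro borel_measurable_continuous_onI continuous_on_pair_cost)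

lemma pair_cost_expand:
  fixes x :: "(real ^ 'n) ^ 'k"
  shows "pair_cost x =
    2 * real CARD('k) * (\<Sum>j\<in>UNIV. (norm (x $ j))\<^sup>2) - 2 * (norm (\<Sum>j\<in>UNIV. x $ j))\<^sup>2"
proof -
  have "pair_cost x = (\<Sum>(j, k)\<in>UNIV. (norm (x $ j - x $ k))\<^sup>2)"
    unfolding pair_cost_def by (rule sum.mono_neutral_left) auto
  also have "\<dots> = (\<Sum>j\<in>UNIV. \<Sum>k\<in>UNIV. (norm (x $ j))\<^sup>2 + (norm (x $ k))\<^sup>2 - 2 * (x $ j \<bullet> x $ k))"
    unfolding UNIV_Times_UNIV[symmetric] sum.cartesian_product[symmetric]
    by (intro sum.cong refl)
      (simp add: power2_norm_eq_inner inner_diff_left inner_diff_right inner_commute)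
  also have "\<dots> = 2 * real CARD('k) * (\<Sum>j\<in>UNIV. (norm (x $ j))\<^sup>2) - 2 * (norm (\<Sum>j\<in>UNIV. x $ j))\<^sup>2"
    unfolding power2_norm_eq_inner
    by (simp add: sum.distrib sum_subtractf sum_distrib_left inner_sum_left inner_sum_right mult_ac)
      (simp add: inner_commute)
  finally show ?thesis .
qed

text \<open>Continuity is phrased coordinatewise because competitors are controlled only through
  their marginals.\<close>

lemma pair_cost_near:
  fixes v :: "(real ^ 'n) ^ 'k"
  assumes "e > 0"
  shows "\<exists>r>0. \<forall>z. (\<forall>j. dist (z $ j) (v $ j) < r) \<longrightarrow> \<bar>pair_cost z - pair_cost v\<bar> < e"
proof -
  obtain d where d: "d > 0" "\<And>z. dist z v < d \<Longrightarrow> \<bar>pair_cost z - pair_cost v\<bar> < e"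
    using continuous_on_pair_cost[of UNIV] assms
    unfolding continuous_on_iff by (metis UNIV_I dist_real_def)
  have "dist z v < d" if "\<forall>j. dist (z $ j) (v $ j) < d / real CARD('k)" for z
  proof -
    have "dist z v \<le> (\<Sum>j\<in>UNIV. dist (z $ j) (v $ j))"
      unfolding dist_vec_def by (rule L2_set_le_sum) auto
    also have "\<dots> < (\<Sum>j\<in>(UNIV :: 'k set). d / real CARD('k))"
      using that by (intro sum_strict_mono) auto
    finally show ?thesis by simp
  qed
  then show ?thesis using d by (intro exI[of _ "d / real CARD('k)"]) auto
qed

lemma emeasure_marginal:
  assumes "sets \<sigma> = sets borel" "E \<in> sets borel"
  shows "emeasure (marginal \<sigma> j) E = emeasure \<sigma> {x. x $ j \<in> E}"
proof -
  have "(\<lambda>x. x $ j) \<in> borel_measurable \<sigma>"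
    using assms(1) by (simp cong: measurable_cong_sets)
  then show ?thesis
    using assms(2) sets_eq_imp_space_eq[OF assms(1)]
    by (simp add: marginal_def emeasure_distr vimage_def)
qed

lemma sets_marginal [simp, measurable_cong]: "sets (marginal \<sigma> j) = sets borel"
  by (simp add: marginal_def)

locale partial_transport =
  fixes \<mu> :: "'k::finite \<Rightarrow> (real ^ 'n) measure" and m :: real
  assumes sets_\<mu>: "\<And>j. sets (\<mu> j) = sets borel"
    and finite_\<mu>: "\<And>j. finite_measure (\<mu> j)"
    and ac_\<mu>: "\<And>j. absolutely_continuous lborel (\<mu> j)"
    and moment_\<mu>: "\<And>j. finite_second_moment (\<mu> j)"
begin

definition feasible :: "((real ^ 'n) ^ 'k) measure \<Rightarrow> bool" where
  "feasible \<sigma> \<longleftrightarrow> \<sigma> \<in> partial_plans \<mu> \<and> total_mass \<sigma> = ennreal m"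

definition optimal :: "((real ^ 'n) ^ 'k) measure \<Rightarrow> bool" where
  "optimal \<sigma> \<longleftrightarrow> is_arg_min transport_cost feasible \<sigma>"

lemma feasible_iff:
  "feasible \<sigma> \<longleftrightarrow> sets \<sigma> = sets borel \<and> emeasure \<sigma> UNIV = ennreal m \<and>
    (\<forall>j. \<forall>E\<in>sets borel. emeasure \<sigma> {x. x $ j \<in> E} \<le> emeasure (\<mu> j) E)"
  unfolding feasible_def partial_plans_def total_mass_def
  by (auto simp: emeasure_marginal dest: sets_eq_imp_space_eq)

lemma optimal_iff:
  "optimal \<sigma> \<longleftrightarrow> feasible \<sigma> \<and> (\<forall>\<tau>. feasible \<tau> \<longrightarrow> transport_cost \<sigma> \<le> transport_cost \<tau>)"
  by (auto simp: optimal_def is_arg_min_linorder)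

lemma feasible_finite: "feasible \<sigma> \<Longrightarrow> finite_measure \<sigma>"
  by (rule finite_measureI) (auto simp: feasible_iff dest: sets_eq_imp_space_eq)

lemma marginal_moment_le:
  assumes "feasible \<sigma>"
  shows "(\<integral>\<^sup>+ x. ennreal ((norm (x $ j))\<^sup>2) \<partial>\<sigma>) \<le> (\<integral>\<^sup>+ x. ennreal ((norm x)\<^sup>2) \<partial>\<mu> j)"
proof -
  have s: "sets \<sigma> = sets borel" using assms by (simp add: feasible_iff)
  have [measurable]: "(\<lambda>x. x $ j) \<in> borel_measurable \<sigma>" by (simp cong: measurable_cong_sets add: s)
  have "(\<integral>\<^sup>+ x. ennreal ((norm (x $ j))\<^sup>2) \<partial>\<sigma>) = (\<integral>\<^sup>+ x. ennreal ((norm x)\<^sup>2) \<partial>marginal \<sigma> j)"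
    unfolding marginal_def by (subst nn_integral_distr) auto
  also have "\<dots> \<le> (\<integral>\<^sup>+ x. ennreal ((norm x)\<^sup>2) \<partial>\<mu> j)"
  proof (rule nn_integral_mono_measure)
    show "marginal \<sigma> j \<le> \<mu> j"
      using assms by (subst le_measure) (auto simp: sets_\<mu> feasible_iff emeasure_marginal)
  qed (auto simp: sets_\<mu>)
  finally show ?thesis .
qed

text \<open>The bound is the same for all feasible plans, which is what compactness of a minimising
  sequence requires.\<close>

lemma norm_moment_le:
  assumes "feasible \<sigma>"
  shows "(\<integral>\<^sup>+ x. ennreal ((norm x)\<^sup>2) \<partial>\<sigma>) \<le> (\<Sum>j\<in>UNIV. \<integral>\<^sup>+ x. ennreal ((norm x)\<^sup>2) \<partial>\<mu> j)"
proof -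
  have s: "sets \<sigma> = sets borel" using assms by (simp add: feasible_iff)
  have [measurable]: "(\<lambda>x. x $ j) \<in> borel_measurable \<sigma>" for j
    by (simp cong: measurable_cong_sets add: s)
  have "(\<integral>\<^sup>+ x. ennreal ((norm x)\<^sup>2) \<partial>\<sigma>) = (\<integral>\<^sup>+ x. (\<Sum>j\<in>UNIV. ennreal ((norm (x $ j))\<^sup>2)) \<partial>\<sigma>)"
    by (simp add: norm_vec_def L2_set_def sum_nonneg)
  also have "\<dots> = (\<Sum>j\<in>UNIV. \<integral>\<^sup>+ x. ennreal ((norm (x $ j))\<^sup>2) \<partial>\<sigma>)"
    by (rule nn_integral_sum) measurable
  also have "\<dots> \<le> (\<Sum>j\<in>UNIV. \<integral>\<^sup>+ x. ennreal ((norm x)\<^sup>2) \<partial>\<mu> j)"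
    by (intro sum_mono marginal_moment_le assms)
  finally show ?thesis .
qed

lemma moment_sum_finite: "(\<Sum>j\<in>UNIV. \<integral>\<^sup>+ x. ennreal ((norm x)\<^sup>2) \<partial>\<mu> j) < \<infinity>"
  using moment_\<mu> by (simp add: finite_second_moment_def)

lemma transport_cost_finite:
  assumes "feasible \<sigma>"
  shows "transport_cost \<sigma> < \<infinity>"
proof -
  have s: "sets \<sigma> = sets borel" using assms by (simp add: feasible_iff)
  have n[measurable]: "(\<lambda>x. ennreal ((norm x)\<^sup>2)) \<in> borel_measurable \<sigma>"
    by (simp cong: measurable_cong_sets add: s)
  have "transport_cost \<sigma> \<le> (\<integral>\<^sup>+ x. ennreal (2 * real CARD('k)) * ennreal ((norm x)\<^sup>2) \<partial>\<sigma>)"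
    unfolding transport_cost_eq
  proof (rule nn_integral_mono)
    fix x :: "(real ^ 'n) ^ 'k"
    have "pair_cost x \<le> 2 * real CARD('k) * (norm x)\<^sup>2"
      unfolding pair_cost_expand by (simp add: norm_vec_def L2_set_def sum_nonneg)
    then show "ennreal (pair_cost x) \<le> ennreal (2 * real CARD('k)) * ennreal ((norm x)\<^sup>2)"
      by (simp add: ennreal_mult[symmetric] ennreal_leI)
  qed
  also have "\<dots> = ennreal (2 * real CARD('k)) * (\<integral>\<^sup>+ x. ennreal ((norm x)\<^sup>2) \<partial>\<sigma>)"
    by (rule nn_integral_cmult[OF n])
  also have "\<dots> < \<infinity>"
    using norm_moment_le[OF assms] moment_sum_finite
    by (auto simp: ennreal_mult_less_top intro: order_le_less_trans)
  finally show ?thesis .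
qed

text \<open>Cut the part \<tau>m out of \<sigma> and put \<tau>p in its place. The result is again
  feasible, and the finite cost of the untouched rest cancels from the comparison. The marginal
  condition is written with sums on both sides because subtraction on \<open>ennreal\<close>
  truncates.\<close>

lemma optimal_exchange:
  assumes opt: "optimal \<sigma>"
    and sets_\<tau>: "sets \<tau>m = sets borel" "sets \<tau>p = sets borel"
    and le: "\<And>A. A \<in> sets borel \<Longrightarrow> emeasure \<tau>m A \<le> emeasure \<sigma> A"
    and mass: "emeasure \<tau>p UNIV = emeasure \<tau>m UNIV"
    and marg: "\<And>j E. E \<in> sets borel \<Longrightarrow>
      emeasure (marginal \<tau>p j) E + emeasure (marginal \<sigma> j) E
        \<le> emeasure (marginal \<tau>m j) E + emeasure (\<mu> j) E"
  shows "transport_cost \<tau>m \<le> transport_cost \<tau>p"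
proof -
  have feas: "feasible \<sigma>" using opt by (simp add: optimal_iff)
  then have s: "sets \<sigma> = sets borel" by (simp add: feasible_iff)
  interpret finite_measure \<sigma> by (rule feasible_finite[OF feas])
  have sp: "space \<sigma> = UNIV" "space \<tau>m = UNIV" "space \<tau>p = UNIV"
    using s sets_\<tau> by (simp_all add: sets_eq_imp_space_eq[of _ borel])
  have \<tau>m_fin: "emeasure \<tau>m A \<noteq> \<infinity>" for A
    by (cases "A \<in> sets borel")
      (use le[of A] emeasure_finite[of A] in \<open>auto simp: emeasure_notin_sets sets_\<tau> top_unique\<close>)
  have "finite_measure \<tau>m" using \<tau>m_fin by (intro finite_measureI) auto
  define \<delta> where "\<delta> = diff_measure \<sigma> \<tau>m"
  have \<delta>: "sets \<delta> = sets borel" "\<And>A. A \<in> sets borel \<Longrightarrow> emeasure \<delta> A = emeasure \<sigma> A - emeasure \<tau>m A"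
    using s sets_\<tau> le \<open>finite_measure \<tau>m\<close> finite_measure_axioms
    by (auto simp: \<delta>_def intro!: emeasure_diff_measure)
  have \<sigma>_eq: "\<sigma> = add_measure \<delta> \<tau>m"
  proof (rule measure_eqI)
    fix A assume "A \<in> sets \<sigma>"
    then have A: "A \<in> sets borel" using s by simp
    then show "emeasure \<sigma> A = emeasure (add_measure \<delta> \<tau>m) A"
      using le[OF A] by (simp add: emeasure_add_measure \<delta> sets_\<tau> diff_add_cancel_ennreal)
  qed (simp add: s \<delta>)
  define \<sigma>' where "\<sigma>' = add_measure \<delta> \<tau>p"
  have \<sigma>': "emeasure \<sigma>' A = emeasure \<sigma> A - emeasure \<tau>m A + emeasure \<tau>p A" if "A \<in> sets borel" for A
    using that by (simp add: \<sigma>'_def emeasure_add_measure \<delta> sets_\<tau>)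
  have "feasible \<sigma>'"
    unfolding feasible_iff
  proof (intro conjI allI ballI)
    show "sets \<sigma>' = sets borel" by (simp add: \<sigma>'_def \<delta>)
    show "emeasure \<sigma>' UNIV = ennreal m"
      using feas le[of UNIV] by (simp add: \<sigma>' mass diff_add_cancel_ennreal feasible_iff)
    fix j and E :: "(real ^ 'n) set" assume E: "E \<in> sets borel"
    let ?A = "{x :: (real ^ 'n) ^ 'k. x $ j \<in> E}"
    have A: "?A \<in> sets borel"
      using measurable_sets[OF borel_measurable_vec_nth E, of j] by (simp add: vimage_def)
    have "emeasure \<sigma>' ?A = emeasure \<tau>p ?A + emeasure \<sigma> ?A - emeasure \<tau>m ?A"
      using le[OF A] by (simp add: \<sigma>'[OF A] add.commute add_diff_eq_ennreal)
    also have "\<dots> \<le> emeasure \<tau>m ?A + emeasure (\<mu> j) E - emeasure \<tau>m ?A"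
      using marg[OF E, of j] by (intro ennreal_minus_mono) (auto simp: emeasure_marginal E s sets_\<tau>)
    also have "\<dots> = emeasure (\<mu> j) E" using \<tau>m_fin by (simp add: ennreal_add_diff_cancel_left)
    finally show "emeasure \<sigma>' ?A \<le> emeasure (\<mu> j) E" .
  qed
  then have "transport_cost \<sigma> \<le> transport_cost \<sigma>'" using opt by (simp add: optimal_iff)
  moreover have pc: "(\<lambda>x. ennreal (pair_cost x)) \<in> borel_measurable \<delta>"
    by (simp cong: measurable_cong_sets add: \<delta>)
  have "transport_cost \<sigma> = transport_cost \<delta> + transport_cost \<tau>m"
    unfolding transport_cost_eq by (subst \<sigma>_eq) (simp add: nn_integral_add_measure pc \<delta> sets_\<tau>)
  moreover have "transport_cost \<sigma>' = transport_cost \<delta> + transport_cost \<tau>p"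
    unfolding transport_cost_eq \<sigma>'_def by (simp add: nn_integral_add_measure pc \<delta> sets_\<tau>)
  ultimately show ?thesis
    using transport_cost_finite[OF feas] by (auto simp: ennreal_add_left_cancel_le)
qed

end

subsection \<open>Existence\<close>

context partial_transport
begin

lemma feasible_exists:
  assumes m: "0 \<le> m" and mass: "\<And>j. ennreal m \<le> emeasure (\<mu> j) UNIV"
  shows "\<exists>\<sigma>. feasible \<sigma>"
proof (cases "m = 0")
  case True
  then have "feasible (null_measure borel)" unfolding feasible_iff by simp
  then show ?thesis ..
next
  case False
  with m have "0 < m" by simp
  define \<alpha> where "\<alpha> j = uniform_measure (\<mu> j) UNIV" for j
  have \<mu>_fin: "emeasure (\<mu> j) UNIV \<noteq> \<infinity>" and \<mu>_pos: "emeasure (\<mu> j) UNIV \<noteq> 0" for j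
    using finite_measure.emeasure_finite[OF finite_\<mu>] mass[of j] \<open>0 < m\<close>
    by (auto simp: top_unique)
  have sets_\<alpha>: "sets (\<alpha> j) = sets borel" for j by (simp add: \<alpha>_def sets_\<mu>)
  have prob: "prob_space (\<alpha> j)" for j
    unfolding \<alpha>_def using \<mu>_fin \<mu>_pos by (rule prob_space_uniform_measure[rotated])
  define \<sigma> where "\<sigma> = scale_measure (ennreal m) (vec_measure \<alpha>)"
  interpret V: prob_space "vec_measure \<alpha>" by (rule prob_space_vec_measure[OF prob sets_\<alpha>])
  have sv: "sets (vec_measure \<alpha>) = sets borel" by (rule sets_vec_measure[OF prob sets_\<alpha>])
  have "feasible \<sigma>"
    unfolding feasible_iff
  proof (intro conjI allI ballI)
    show "sets \<sigma> = sets borel" by (simp add: \<sigma>_def sv)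
    show "emeasure \<sigma> UNIV = ennreal m"
      using V.emeasure_space_1 sets_eq_imp_space_eq[OF sv] by (simp add: \<sigma>_def)
    fix j and E :: "(real ^ 'n) set" assume E: "E \<in> sets borel"
    have "emeasure (vec_measure \<alpha>) {x. x $ j \<in> E} = emeasure (\<alpha> j) E"
      using emeasure_marginal[OF sv E, of j]
      by (simp add: marginal_def distr_vec_measure[OF prob sets_\<alpha>])
    also have "\<dots> = emeasure (\<mu> j) E / emeasure (\<mu> j) UNIV"
      unfolding \<alpha>_def using E by (subst emeasure_uniform_measure) (auto simp: sets_\<mu>)
    finally have "emeasure \<sigma> {x. x $ j \<in> E} = ennreal m * (emeasure (\<mu> j) E / emeasure (\<mu> j) UNIV)"
      by (simp add: \<sigma>_def)
    also have "\<dots> \<le> emeasure (\<mu> j) UNIV * (emeasure (\<mu> j) E / emeasure (\<mu> j) UNIV)"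
      by (intro mult_right_mono mass) auto
    also have "\<dots> = emeasure (\<mu> j) E"
      using \<mu>_fin[of j] \<mu>_pos[of j]
      by (simp add: ennreal_times_divide mult.commute ennreal_mult_divide_eq)
    finally show "emeasure \<sigma> {x. x $ j \<in> E} \<le> emeasure (\<mu> j) E" .
  qed
  then show ?thesis ..
qed

lemma optimal_exists:
  assumes m: "0 \<le> m" and mass: "\<And>j. ennreal m \<le> emeasure (\<mu> j) UNIV"
  shows "\<exists>\<sigma>. optimal \<sigma>"
proof (cases "m = 0")
  case True
  then have "feasible (null_measure borel)" unfolding feasible_iff by simp
  then have "optimal (null_measure borel)"
    by (simp add: optimal_iff transport_cost_def)
  then show ?thesis ..
next
  case False
  with m have m0: "0 < m" by simp
  define I where "I = (INF \<tau>\<in>{\<tau>. feasible \<tau>}. transport_cost \<tau>)"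
  have I_le: "I \<le> transport_cost \<tau>" if "feasible \<tau>" for \<tau>
    unfolding I_def using that by (intro INF_lower) auto
  have "I < \<infinity>"
    using feasible_exists[OF assms] transport_cost_finite I_le by (meson order_le_less_trans)
  then obtain i where i: "0 \<le> i" "I = ennreal i" by (cases I) auto
  have "\<exists>\<tau>. feasible \<tau> \<and> transport_cost \<tau> \<le> ennreal (i + 1 / real (Suc n))" for n
  proof -
    have "I < ennreal (i + 1 / real (Suc n))"
      unfolding i using i(1) by (intro ennreal_lessI) (auto intro: add_nonneg_pos)
    then show ?thesis unfolding I_def INF_less_iff by (auto intro: less_imp_le)
  qed
  then obtain T where T: "\<And>n. feasible (T n)" "\<And>n. transport_cost (T n) \<le> ennreal (i + 1 / real (Suc n))"
    by metis
  have sT: "sets (T n) = sets borel" for n using T(1) by (simp add: feasible_iff)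
  define P where "P n = scale_measure (ennreal (1 / m)) (T n)" for n
  have sP[measurable_cong]: "sets (P n) = sets borel" for n by (simp add: P_def sT)
  have mm: "ennreal (1 / m) * ennreal m = 1"
    using m0 by (simp add: ennreal_mult[symmetric] ennreal_1[symmetric] del: ennreal_1)
  have probP: "prob_space (P n)" for n
  proof
    have "emeasure (T n) UNIV = ennreal m" using T(1) by (simp add: feasible_iff)
    then show "emeasure (P n) (space (P n)) = 1"
      using sets_eq_imp_space_eq[OF sP] by (simp add: P_def mm)
  qed
  have int_P: "(\<integral>\<^sup>+ x. f x \<partial>P n) = ennreal (1 / m) * (\<integral>\<^sup>+ x. f x \<partial>T n)"
    if "f \<in> borel_measurable borel" for f n
    unfolding P_def using that
    by (intro nn_integral_scale_measure) (simp cong: measurable_cong_sets add: sT)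
  obtain r :: "nat \<Rightarrow> nat" and \<Omega> :: "real measure" and Y X
    where r: "strict_mono r" and \<Omega>: "prob_space \<Omega>"
      and Y[measurable]: "\<And>n. Y n \<in> borel_measurable \<Omega>" and distr_Y: "\<And>n. distr \<Omega> borel (Y n) = P (r n)"
      and X[measurable]: "X \<in> borel_measurable \<Omega>" and lim: "AE \<omega> in \<Omega>. (\<lambda>n. Y n \<omega>) \<longlonglongrightarrow> X \<omega>"
  proof (rule skorohod_subsequence[where P = P and C = "ennreal (1 / m) * (\<Sum>j\<in>UNIV. \<integral>\<^sup>+ x. ennreal ((norm x)\<^sup>2) \<partial>\<mu> j)", OF probP sP])
    let ?C = "\<Sum>j\<in>UNIV. \<integral>\<^sup>+ x. ennreal ((norm x)\<^sup>2) \<partial>\<mu> j"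
    show "(\<integral>\<^sup>+ x. ennreal ((norm x)\<^sup>2) \<partial>P n) \<le> ennreal (1 / m) * ?C" for n
      by (subst int_P) (auto intro!: mult_left_mono norm_moment_le T(1))
    show "ennreal (1 / m) * ?C < \<infinity>"
      using moment_sum_finite by (simp add: ennreal_mult_less_top)
  qed (rule that; assumption)
  \<comment> \<open>One semicontinuity statement serves twice: for the cost, and for indicators of
    open sets, which carry the marginal constraints to the limit.\<close>
  have fatou: "(\<integral>\<^sup>+ \<omega>. f (X \<omega>) \<partial>\<Omega>) \<le> liminf (\<lambda>n. \<integral>\<^sup>+ x. f x \<partial>P (r n))"
    if f[measurable]: "f \<in> borel_measurable borel"
      and lsc: "\<And>y x. y \<longlonglongrightarrow> x \<Longrightarrow> f x \<le> liminf (\<lambda>n. f (y n))" for f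
  proof -
    have "(\<integral>\<^sup>+ \<omega>. f (X \<omega>) \<partial>\<Omega>) \<le> (\<integral>\<^sup>+ \<omega>. liminf (\<lambda>n. f (Y n \<omega>)) \<partial>\<Omega>)"
      by (intro nn_integral_mono_AE eventually_mono[OF lim]) (rule lsc)
    also have "\<dots> \<le> liminf (\<lambda>n. \<integral>\<^sup>+ \<omega>. f (Y n \<omega>) \<partial>\<Omega>)"
      by (rule nn_integral_liminf) measurable
    also have "(\<lambda>n. \<integral>\<^sup>+ \<omega>. f (Y n \<omega>) \<partial>\<Omega>) = (\<lambda>n. \<integral>\<^sup>+ x. f x \<partial>P (r n))"
      unfolding distr_Y[symmetric] by (subst nn_integral_distr) auto
    finally show ?thesis .
  qed
  define \<sigma> where "\<sigma> = scale_measure (ennreal m) (distr \<Omega> borel X)"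
  have int_\<sigma>: "(\<integral>\<^sup>+ x. f x \<partial>\<sigma>) = ennreal m * (\<integral>\<^sup>+ \<omega>. f (X \<omega>) \<partial>\<Omega>)"
    if "f \<in> borel_measurable borel" for f
    unfolding \<sigma>_def using that by (simp add: nn_integral_scale_measure nn_integral_distr)
  have "feasible \<sigma>"
    unfolding feasible_iff
  proof (intro conjI allI ballI)
    show "sets \<sigma> = sets borel" by (simp add: \<sigma>_def)
    show "emeasure \<sigma> UNIV = ennreal m"
      using prob_space.emeasure_space_1[OF \<Omega>] by (simp add: \<sigma>_def emeasure_distr)
    fix j and E :: "(real ^ 'n) set" assume E: "E \<in> sets borel"
    \<comment> \<open>Indicators are lower semicontinuous for open sets only; outer regularity of
      the finite measure \<mu>_j then reaches every Borel set \<open>E\<close>.\<close>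
    have *: "emeasure \<sigma> {x. x $ j \<in> E} \<le> emeasure (\<mu> j) U" if U: "open U" "E \<subseteq> U" for U
    proof -
      define V where "V = {x :: (real ^ 'n) ^ 'k. x $ j \<in> U}"
      have V: "open V"
        unfolding V_def using open_vimage[OF U(1), of "\<lambda>x. x $ j"]
        by (simp add: vimage_def continuous_on_component)
      have [measurable]: "indicator V \<in> borel_measurable (borel :: ((real ^ 'n) ^ 'k) measure)"
        using V by (intro borel_measurable_indicator) auto
      have lsc: "indicator V x \<le> liminf (\<lambda>n. indicator V (y n) :: ennreal)" if "y \<longlonglongrightarrow> x" for y x
      proof (cases "x \<in> V")
        case True
        then have "\<forall>\<^sub>F n in sequentially. y n \<in> V" using topological_tendstoD[OF that V] by simp
        then show ?thesis by (intro Liminf_bounded) (auto elim!: eventually_mono split: split_indicator)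
      qed simp
      have "emeasure \<sigma> {x. x $ j \<in> E} \<le> emeasure \<sigma> V"
        unfolding V_def using U(2) V by (intro emeasure_mono) (auto simp: \<sigma>_def V_def)
      also have "\<dots> = (\<integral>\<^sup>+ x. indicator V x \<partial>\<sigma>)"
        using V by (simp add: \<sigma>_def)
      also have "\<dots> = ennreal m * (\<integral>\<^sup>+ \<omega>. indicator V (X \<omega>) \<partial>\<Omega>)"
        by (rule int_\<sigma>) measurable
      also have "\<dots> \<le> ennreal m * liminf (\<lambda>n. \<integral>\<^sup>+ x. indicator V x \<partial>P (r n))"
        by (intro mult_left_mono fatou lsc) auto
      also have "\<dots> \<le> ennreal m * liminf (\<lambda>n. ennreal (1 / m) * emeasure (\<mu> j) U)"
      proof (intro mult_left_mono Liminf_mono always_eventually allI)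
        fix n
        have "(\<integral>\<^sup>+ x. indicator V x \<partial>P (r n)) = ennreal (1 / m) * emeasure (T (r n)) V"
          using V by (subst int_P) (auto simp: sT)
        also have "\<dots> \<le> ennreal (1 / m) * emeasure (\<mu> j) U"
          using T(1)[of "r n"] U(1) by (intro mult_left_mono) (auto simp: feasible_iff V_def)
        finally show "(\<integral>\<^sup>+ x. indicator V x \<partial>P (r n)) \<le> ennreal (1 / m) * emeasure (\<mu> j) U" .
      qed auto
      also have "\<dots> = emeasure (\<mu> j) U"
        using mm by (simp add: Liminf_const mult.assoc[symmetric] mult.commute)
      finally show ?thesis .
    qed
    have "emeasure (\<mu> j) E = (INF U\<in>{U. E \<subseteq> U \<and> open U}. emeasure (\<mu> j) U)"
      using finite_measure.emeasure_finite[OF finite_\<mu>] E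
      by (intro outer_regular) (auto simp: sets_\<mu>)
    then show "emeasure \<sigma> {x. x $ j \<in> E} \<le> emeasure (\<mu> j) E"
      using * by (auto intro!: INF_greatest)
  qed
  moreover have "transport_cost \<sigma> \<le> I"
  proof -
    have lsc: "ennreal (pair_cost x) \<le> liminf (\<lambda>n. ennreal (pair_cost (y n)))" if "y \<longlonglongrightarrow> x" for y x
    proof -
      have "(\<lambda>n. pair_cost (y n)) \<longlonglongrightarrow> pair_cost x"
        using that continuous_on_pair_cost[of UNIV]
        by (auto simp: continuous_on_def intro: tendsto_compose)
      then have "(\<lambda>n. ennreal (pair_cost (y n))) \<longlonglongrightarrow> ennreal (pair_cost x)" by (rule tendsto_ennrealI)
      then show ?thesis by (simp add: lim_imp_Liminf)
    qed
    have "transport_cost \<sigma> = ennreal m * (\<integral>\<^sup>+ \<omega>. ennreal (pair_cost (X \<omega>)) \<partial>\<Omega>)"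
      unfolding transport_cost_eq by (rule int_\<sigma>) measurable
    also have "\<dots> \<le> ennreal m * liminf (\<lambda>n. \<integral>\<^sup>+ x. ennreal (pair_cost x) \<partial>P (r n))"
      by (intro mult_left_mono fatou lsc) auto
    also have "\<dots> \<le> ennreal m * liminf (\<lambda>n. ennreal (1 / m * (i + 1 / real (Suc (r n)))))"
    proof (intro mult_left_mono Liminf_mono always_eventually allI)
      fix n
      have "(\<integral>\<^sup>+ x. ennreal (pair_cost x) \<partial>P (r n)) = ennreal (1 / m) * transport_cost (T (r n))"
        unfolding transport_cost_eq by (rule int_P) measurable
      also have "\<dots> \<le> ennreal (1 / m) * ennreal (i + 1 / real (Suc (r n)))"
        by (intro mult_left_mono T(2)) auto
      also have "\<dots> = ennreal (1 / m * (i + 1 / real (Suc (r n))))"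
        using m0 i(1) by (intro ennreal_mult[symmetric]) auto
      finally show "(\<integral>\<^sup>+ x. ennreal (pair_cost x) \<partial>P (r n))
        \<le> ennreal (1 / m * (i + 1 / real (Suc (r n))))" .
    qed auto
    also have "liminf (\<lambda>n. ennreal (1 / m * (i + 1 / real (Suc (r n))))) = ennreal (1 / m * i)"
    proof (rule lim_imp_Liminf)
      have "(\<lambda>n. 1 / real (Suc (r n))) \<longlonglongrightarrow> 0"
        using LIMSEQ_subseq_LIMSEQ[OF LIMSEQ_Suc[OF lim_1_over_n] r] by (simp add: comp_def)
      then have "(\<lambda>n. 1 / m * (i + 1 / real (Suc (r n)))) \<longlonglongrightarrow> 1 / m * (i + 0)"
        by (intro tendsto_intros)
      then show "(\<lambda>n. ennreal (1 / m * (i + 1 / real (Suc (r n))))) \<longlonglongrightarrow> ennreal (1 / m * i)"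
        by (intro tendsto_ennrealI) simp
    qed simp
    also have "ennreal m * ennreal (1 / m * i) = I"
      using m0 i by (simp add: ennreal_mult[symmetric])
    finally show ?thesis .
  qed
  ultimately have "optimal \<sigma>"
    using I_le by (auto simp: optimal_iff intro: order_trans)
  then show ?thesis ..
qed

end

subsection \<open>Exchanging mass\<close>

lemma ennreal_half_times: "(1 / 2) * c = c / 2" for c :: ennreal
  by (metis ennreal_times_divide mult.commute mult_1_right)

lemma ennreal_halves: "c / 2 + c / 2 = c" for c :: ennreal
proof -
  have "c / 2 + c / 2 = (c * 2) / 2"
    by (simp add: add_divide_distrib_ennreal[symmetric] mult_2_right)
  also have "\<dots> = c" by (rule ennreal_mult_divide_eq) auto
  finally show ?thesis .
qed

lemma (in prob_space) nn_integral_le_const: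
  assumes "AE x in M. f x \<le> c"
  shows "(\<integral>\<^sup>+ x. f x \<partial>M) \<le> c"
  using nn_integral_mono_AE[OF assms] by (simp add: emeasure_space_1)

lemma (in prob_space) nn_integral_ge_const:
  assumes "AE x in M. c \<le> f x"
  shows "c \<le> (\<integral>\<^sup>+ x. f x \<partial>M)"
  using nn_integral_mono_AE[OF assms] by (simp add: emeasure_space_1)

context partial_transport
begin

definition residual :: "((real ^ 'n) ^ 'k) measure \<Rightarrow> 'k \<Rightarrow> (real ^ 'n) measure" where
  "residual \<sigma> j = diff_measure (\<mu> j) (marginal \<sigma> j)"

lemma sets_residual [simp]: "sets (residual \<sigma> j) = sets borel"
  by (simp add: residual_def sets_\<mu>)

lemma marginal_le: "feasible \<sigma> \<Longrightarrow> E \<in> sets borel \<Longrightarrow> emeasure (marginal \<sigma> j) E \<le> emeasure (\<mu> j) E"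
  by (auto simp: feasible_iff emeasure_marginal)

lemma finite_measure_marginal: "feasible \<sigma> \<Longrightarrow> finite_measure (marginal \<sigma> j)"
  using marginal_le[of \<sigma> UNIV j] finite_measure.emeasure_finite[OF finite_\<mu>, of j UNIV]
  by (intro finite_measureI) (auto simp: marginal_def top_unique)

lemma emeasure_residual:
  assumes "feasible \<sigma>" "E \<in> sets borel"
  shows "emeasure (residual \<sigma> j) E + emeasure (marginal \<sigma> j) E = emeasure (\<mu> j) E"
proof -
  have "emeasure (residual \<sigma> j) E = emeasure (\<mu> j) E - emeasure (marginal \<sigma> j) E"
    unfolding residual_def using assms marginal_le[OF assms(1)]
    by (intro emeasure_diff_measure finite_\<mu> finite_measure_marginal) (auto simp: sets_\<mu>)
  then show ?thesis using marginal_le[OF assms] by (simp add: diff_add_cancel_ennreal)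
qed

lemma pair_cost_exchange:
  assumes opt: "optimal \<sigma>"
    and x: "x \<in> measure_support \<sigma>" and x': "x' \<in> measure_support \<sigma>"
    and y: "\<And>j. y $ j = x $ j \<and> y' $ j = x' $ j \<or> y $ j = x' $ j \<and> y' $ j = x $ j \<or>
      y $ j \<in> measure_support (residual \<sigma> j) \<and> y' $ j = x' $ j"
  shows "pair_cost x + pair_cost x' \<le> pair_cost y + pair_cost y'"
proof (rule field_le_epsilon)
  fix e :: real assume "0 < e"
  \<comment> \<open>One error for each of the four points x, x', y and y'.\<close>
  define \<epsilon> where "\<epsilon> = e / 4"
  have "\<epsilon> > 0" using \<open>0 < e\<close> by (simp add: \<epsilon>_def)
  have feas: "feasible \<sigma>" using opt by (simp add: optimal_iff)
  then have s: "sets \<sigma> = sets borel" by (simp add: feasible_iff)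
  interpret finite_measure \<sigma> by (rule feasible_finite[OF feas])
  have "\<forall>v :: (real ^ 'n) ^ 'k. \<exists>r>0. \<forall>z. (\<forall>j. dist (z $ j) (v $ j) < r) \<longrightarrow> \<bar>pair_cost z - pair_cost v\<bar> < \<epsilon>"
    using pair_cost_near[OF \<open>\<epsilon> > 0\<close>] by blast
  from choice[OF this] obtain R where R': "\<forall>v :: (real ^ 'n) ^ 'k. R v > 0 \<and>
      (\<forall>z. (\<forall>j. dist (z $ j) (v $ j) < R v) \<longrightarrow> \<bar>pair_cost z - pair_cost v\<bar> < \<epsilon>)"
    by blast
  then have R: "R v > 0" "(\<And>j. dist (z $ j) (v $ j) < R v) \<Longrightarrow> \<bar>pair_cost z - pair_cost v\<bar> < \<epsilon>" for v z
    by auto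
  define r where "r = Min (R ` {x, x', y, y'})"
  have r: "r > 0" "r \<le> R x" "r \<le> R x'" "r \<le> R y" "r \<le> R y'"
    using R(1) by (auto simp: r_def)
  define \<rho> where "\<rho> v = uniform_measure \<sigma> (ball v r)" for v
  have ball_pos: "emeasure \<sigma> (ball v r) \<noteq> 0" if "v \<in> measure_support \<sigma>" for v
    using that r(1) by (auto simp: measure_support_def)
  have s\<rho>: "sets (\<rho> v) = sets borel" for v by (simp add: \<rho>_def s)
  have prob_\<rho>: "prob_space (\<rho> v)" if "v \<in> measure_support \<sigma>" for v
    unfolding \<rho>_def using ball_pos[OF that] by (intro prob_space_uniform_measure) auto
  have AE_\<rho>: "AE z in \<rho> v. z \<in> ball v r" for v
    unfolding \<rho>_def by (rule AE_uniform_measureI) (auto simp: s)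
  have marg_\<rho>: "prob_space (marginal (\<rho> v) j) \<and> (AE z in marginal (\<rho> v) j. dist z (v $ j) < r)"
    if "v \<in> measure_support \<sigma>" for v j
  proof -
    have [measurable]: "(\<lambda>x. x $ j) \<in> borel_measurable (\<rho> v)"
      by (simp cong: measurable_cong_sets add: s\<rho>)
    have "AE z in \<rho> v. dist (z $ j) (v $ j) < r"
      using AE_\<rho>[of v]
    proof eventually_elim
      case (elim z)
      then show ?case using dist_vec_nth_le[of z j v] by (simp add: dist_commute)
    qed
    then show ?thesis
      unfolding marginal_def
      by (auto simp: AE_distr_iff intro!: prob_space.prob_space_distr[OF prob_\<rho>[OF that]])
  qed
  define S where "S = {emeasure \<sigma> (ball x r) / 2, emeasure \<sigma> (ball x' r) / 2} \<union>
    (\<lambda>j. if y $ j \<in> measure_support (residual \<sigma> j) then emeasure (residual \<sigma> j) (ball (y $ j) r) else 1) ` UNIV"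
  define a where "a = Min S"
  have "finite S" by (simp add: S_def)
  have a_le: "a \<le> c" if "c \<in> S" for c unfolding a_def using \<open>finite S\<close> that by (rule Min_le)
  have "a \<in> S" unfolding a_def using \<open>finite S\<close> by (intro Min_in) (auto simp: S_def)
  moreover have "c \<noteq> 0" if "c \<in> S" for c
    using that ball_pos[OF x] ball_pos[OF x'] r(1)
    by (auto simp: S_def measure_support_def ennreal_divide_eq_0_iff split: if_splits)
  ultimately have "a \<noteq> 0" by blast
  have a_x: "a \<le> emeasure \<sigma> (ball x r) / 2" "a \<le> emeasure \<sigma> (ball x' r) / 2"
    by (rule a_le, simp add: S_def)+
  have "a \<noteq> \<top>"
    using a_x(1) emeasure_finite[of "ball x r"] by (auto simp: top_unique ennreal_divide_eq_top_iff)
  have a_res: "a \<le> emeasure (residual \<sigma> j) (ball (y $ j) r)"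
    if "y $ j \<in> measure_support (residual \<sigma> j)" for j
    using that by (intro a_le) (auto simp: S_def)
  have part_le: "a * emeasure (uniform_measure M B) A \<le> c * emeasure M A"
    if "a \<le> c * emeasure M B" "emeasure M B \<noteq> 0" "emeasure M B \<noteq> \<top>" "A \<in> sets M" "B \<in> sets M"
    for M :: "'z measure" and A B c
  proof -
    have "a * emeasure (uniform_measure M B) A \<le> (c * emeasure M B) * (emeasure M (B \<inter> A) / emeasure M B)"
      using that by (simp add: mult_right_mono)
    also have "\<dots> = (c * emeasure M (B \<inter> A)) * emeasure M B / emeasure M B"
      by (simp add: ennreal_times_divide mult_ac)
    also have "\<dots> = c * emeasure M (B \<inter> A)"
      using that(2,3) by (intro ennreal_mult_divide_eq) auto
    also have "\<dots> \<le> c * emeasure M A"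
      using that by (intro mult_left_mono emeasure_mono) auto
    finally show ?thesis .
  qed
  \<comment> \<open>\<open>p\<close> and \<open>q\<close> are the laws of the j-th coordinates of
    the competitors near y and y'. The final inequality is the marginal hypothesis of
    \<open>optimal_exchange\<close>.\<close>
  have "\<exists>p q. prob_space p \<and> prob_space q \<and> sets p = sets borel \<and> sets q = sets borel \<and>
      (AE z in p. dist z (y $ j) < r) \<and> (AE z in q. dist z (y' $ j) < r) \<and>
      (\<forall>E\<in>sets borel. a * emeasure p E + a * emeasure q E + emeasure (marginal \<sigma> j) E
        \<le> a * emeasure (marginal (\<rho> x) j) E + a * emeasure (marginal (\<rho> x') j) E + emeasure (\<mu> j) E)" for j
    using y[of j]
  proof (elim disjE)
    assume "y $ j = x $ j \<and> y' $ j = x' $ j"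
    then show ?thesis
      using marg_\<rho>[OF x, of j] marg_\<rho>[OF x', of j] marginal_le[OF feas]
      by - (rule exI[of _ "marginal (\<rho> x) j"], rule exI[of _ "marginal (\<rho> x') j"],
          auto intro!: add_left_mono)
  next
    assume "y $ j = x' $ j \<and> y' $ j = x $ j"
    then show ?thesis
      using marg_\<rho>[OF x, of j] marg_\<rho>[OF x', of j] marginal_le[OF feas]
      by - (rule exI[of _ "marginal (\<rho> x') j"], rule exI[of _ "marginal (\<rho> x) j"],
          auto intro!: add_mono simp: add.commute)
  next
    assume *: "y $ j \<in> measure_support (residual \<sigma> j) \<and> y' $ j = x' $ j"
    let ?B = "ball (y $ j) r" and ?M = "residual \<sigma> j"
    have pos: "emeasure ?M ?B \<noteq> 0" using * r(1) by (auto simp: measure_support_def)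
    have fin: "emeasure ?M ?B \<noteq> \<top>"
      using emeasure_residual[OF feas, of ?B j] finite_measure.emeasure_finite[OF finite_\<mu>, of j ?B]
      by (metis borel_open ennreal_add_eq_top infinity_ennreal_def open_ball)
    show ?thesis
    proof (rule exI[of _ "uniform_measure ?M ?B"], rule exI[of _ "marginal (\<rho> x') j"], intro conjI ballI)
      show "prob_space (uniform_measure ?M ?B)" using pos fin by (intro prob_space_uniform_measure) auto
      show "AE z in uniform_measure ?M ?B. dist z (y $ j) < r"
        by (rule AE_uniform_measureI) (auto simp: dist_commute)
      fix E :: "(real ^ 'n) set" assume E: "E \<in> sets borel"
      have "a * emeasure (uniform_measure ?M ?B) E \<le> 1 * emeasure ?M E"
        using a_res * pos fin E by (intro part_le) auto
      then have "a * emeasure (uniform_measure ?M ?B) E + emeasure (marginal \<sigma> j) E \<le> emeasure (\<mu> j) E"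
        using emeasure_residual[OF feas E, of j] by (metis add_right_mono mult_1)
      \<comment> \<open>The mass released near \<open>x $ j\<close> is simply given up, which
        accounts for the extra term on the right.\<close>
      then have "a * emeasure (marginal (\<rho> x') j) E + (a * emeasure (uniform_measure ?M ?B) E + emeasure (marginal \<sigma> j) E)
        \<le> a * emeasure (marginal (\<rho> x) j) E + (a * emeasure (marginal (\<rho> x') j) E + emeasure (\<mu> j) E)"
        by (intro add_increasing[OF zero_le] add_left_mono)
      then show "a * emeasure (uniform_measure ?M ?B) E + a * emeasure (marginal (\<rho> x') j) E + emeasure (marginal \<sigma> j) E
        \<le> a * emeasure (marginal (\<rho> x) j) E + a * emeasure (marginal (\<rho> x') j) E + emeasure (\<mu> j) E"
        by (simp add: ac_simps)
    qed (use * marg_\<rho>[OF x', of j] in auto)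
  qed
  then obtain p q where pq: "\<And>j. prob_space (p j)" "\<And>j. prob_space (q j)"
    "\<And>j. sets (p j) = sets borel" "\<And>j. sets (q j) = sets borel"
    "\<And>j. AE z in p j. dist z (y $ j) < r" "\<And>j. AE z in q j. dist z (y' $ j) < r"
    and marg_pq: "\<And>j E. E \<in> sets borel \<Longrightarrow> a * emeasure (p j) E + a * emeasure (q j) E + emeasure (marginal \<sigma> j) E
        \<le> a * emeasure (marginal (\<rho> x) j) E + a * emeasure (marginal (\<rho> x') j) E + emeasure (\<mu> j) E"
    by metis
  define mix where "mix M N = add_measure (scale_measure a M) (scale_measure a N)"
    for M N :: "((real ^ 'n) ^ 'k) measure"
  have sets_mix: "sets (mix M N) = sets borel" if "sets M = sets borel" for M N
    using that by (simp add: mix_def)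
  have emeasure_mix: "emeasure (mix M N) A = a * emeasure M A + a * emeasure N A"
    if "sets M = sets borel" "sets N = sets borel" "A \<in> sets borel" for M N A
    using that by (simp add: mix_def emeasure_add_measure)
  have cost_mix: "transport_cost (mix M N) =
      a * ((\<integral>\<^sup>+ x. ennreal (pair_cost x) \<partial>M) + (\<integral>\<^sup>+ x. ennreal (pair_cost x) \<partial>N))"
    if "sets M = sets borel" "sets N = sets borel" for M N
  proof -
    have "(\<lambda>x. ennreal (pair_cost x)) \<in> borel_measurable M" "(\<lambda>x. ennreal (pair_cost x)) \<in> borel_measurable N"
      "(\<lambda>x. ennreal (pair_cost x)) \<in> borel_measurable (scale_measure a M)"
      using that by (simp_all cong: measurable_cong_sets)
    with that show ?thesis
      by (simp add: transport_cost_eq mix_def nn_integral_add_measure nn_integral_scale_measure distrib_left)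
  qed
  have marginal_mix: "emeasure (marginal (mix M N) j) E = a * emeasure (marginal M j) E + a * emeasure (marginal N j) E"
    if "sets M = sets borel" "sets N = sets borel" "E \<in> sets borel" for M N j E
  proof -
    have "{x :: (real ^ 'n) ^ 'k. x $ j \<in> E} \<in> sets borel"
      using measurable_sets[OF borel_measurable_vec_nth that(3), of j] by (simp add: vimage_def)
    then show ?thesis using that by (simp add: emeasure_marginal emeasure_mix sets_mix)
  qed
  have sv: "sets (vec_measure p) = sets borel" "sets (vec_measure q) = sets borel"
    by (rule sets_vec_measure[OF pq(1,3)], rule sets_vec_measure[OF pq(2,4)])
  have pv: "prob_space (vec_measure p)" "prob_space (vec_measure q)"
    by (rule prob_space_vec_measure[OF pq(1,3)], rule prob_space_vec_measure[OF pq(2,4)])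
  have mv: "marginal (vec_measure p) j = p j" "marginal (vec_measure q) j = q j" for j
    unfolding marginal_def by (rule distr_vec_measure[OF pq(1,3)], rule distr_vec_measure[OF pq(2,4)])
  have one: "emeasure M UNIV = 1" if "prob_space M" "sets M = sets borel" for M :: "((real ^ 'n) ^ 'k) measure"
    using prob_space.emeasure_space_1[OF that(1)] sets_eq_imp_space_eq[OF that(2)] by simp
  have "transport_cost (mix (\<rho> x) (\<rho> x')) \<le> transport_cost (mix (vec_measure p) (vec_measure q))"
  proof (rule optimal_exchange[OF opt])
    fix A :: "((real ^ 'n) ^ 'k) set" assume A: "A \<in> sets borel"
    have half: "a * emeasure (\<rho> v) A \<le> (1 / 2) * emeasure \<sigma> A"
      if "v \<in> measure_support \<sigma>" "a \<le> emeasure \<sigma> (ball v r) / 2" for v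
      unfolding \<rho>_def using that ball_pos emeasure_finite[of "ball v r"] A
      by (intro part_le) (auto simp: s ennreal_half_times)
    have "emeasure (mix (\<rho> x) (\<rho> x')) A \<le> (1 / 2) * emeasure \<sigma> A + (1 / 2) * emeasure \<sigma> A"
      using A by (simp only: emeasure_mix[OF s\<rho> s\<rho> A]) (intro add_mono half x x' a_x)
    also have "\<dots> = emeasure \<sigma> A"
      by (simp only: ennreal_half_times ennreal_halves)
    finally show "emeasure (mix (\<rho> x) (\<rho> x')) A \<le> emeasure \<sigma> A" .
  next
    show "emeasure (mix (vec_measure p) (vec_measure q)) UNIV = emeasure (mix (\<rho> x) (\<rho> x')) UNIV"
      using one pv sv prob_\<rho> x x' s\<rho> by (simp add: emeasure_mix)
  next
    fix j and E :: "(real ^ 'n) set" assume E: "E \<in> sets borel"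
    show "emeasure (marginal (mix (vec_measure p) (vec_measure q)) j) E + emeasure (marginal \<sigma> j) E
      \<le> emeasure (marginal (mix (\<rho> x) (\<rho> x')) j) E + emeasure (\<mu> j) E"
      using marg_pq[OF E, of j] by (simp add: marginal_mix sv s\<rho> E mv)
  qed (simp_all add: sets_mix sv s\<rho>)
  then have le: "(\<integral>\<^sup>+ z. ennreal (pair_cost z) \<partial>\<rho> x) + (\<integral>\<^sup>+ z. ennreal (pair_cost z) \<partial>\<rho> x')
      \<le> (\<integral>\<^sup>+ z. ennreal (pair_cost z) \<partial>vec_measure p) + (\<integral>\<^sup>+ z. ennreal (pair_cost z) \<partial>vec_measure q)"
    using \<open>a \<noteq> 0\<close> \<open>a \<noteq> \<top>\<close> by (simp add: cost_mix sv s\<rho> ennreal_mult_le_mult_iff)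
  \<comment> \<open>The maximum with 0 makes the bound nonnegative, so that
    \<open>ennreal_plus\<close> can later merge the two bounds.\<close>
  have lower: "ennreal (max 0 (pair_cost v - \<epsilon>)) \<le> (\<integral>\<^sup>+ z. ennreal (pair_cost z) \<partial>\<rho> v)"
    if "v \<in> measure_support \<sigma>" "r \<le> R v" for v
  proof (rule prob_space.nn_integral_ge_const[OF prob_\<rho>[OF that(1)]])
    show "AE z in \<rho> v. ennreal (max 0 (pair_cost v - \<epsilon>)) \<le> ennreal (pair_cost z)"
      using AE_\<rho>[of v]
    proof eventually_elim
      case (elim z)
      have "dist (z $ j) (v $ j) < R v" for j
        using dist_vec_nth_le[of z j v] elim that(2) by (simp add: dist_commute)
      then have "\<bar>pair_cost z - pair_cost v\<bar> < \<epsilon>" by (rule R(2))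
      then show ?case using pair_cost_nonneg[of z] by (intro ennreal_leI) auto
    qed
  qed
  have upper: "(\<integral>\<^sup>+ z. ennreal (pair_cost z) \<partial>vec_measure \<alpha>) \<le> ennreal (pair_cost v + \<epsilon>)"
    if \<alpha>: "\<And>j. prob_space (\<alpha> j)" "\<And>j. sets (\<alpha> j) = sets borel"
      and near: "\<And>j. AE z in \<alpha> j. dist z (v $ j) < r" and "r \<le> R v" for \<alpha> v
  proof (rule prob_space.nn_integral_le_const[OF prob_space_vec_measure[OF \<alpha>]])
    have "AE z in vec_measure \<alpha>. dist (z $ j) (v $ j) < r" for j
    proof (rule AE_distrD[where f = "\<lambda>z. z $ j" and M' = borel and P = "\<lambda>z. dist z (v $ j) < r"])
      show "(\<lambda>z. z $ j) \<in> borel_measurable (vec_measure \<alpha>)"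
        by (simp cong: measurable_cong_sets add: sets_vec_measure[OF \<alpha>])
      show "AE z in distr (vec_measure \<alpha>) borel (\<lambda>z. z $ j). dist z (v $ j) < r"
        by (subst distr_vec_measure[OF \<alpha>]) (rule near)
    qed
    then have "AE z in vec_measure \<alpha>. \<forall>j. dist (z $ j) (v $ j) < r"
      by (simp add: AE_all_countable)
    then show "AE z in vec_measure \<alpha>. ennreal (pair_cost z) \<le> ennreal (pair_cost v + \<epsilon>)"
    proof eventually_elim
      case (elim z)
      then have "\<bar>pair_cost z - pair_cost v\<bar> < \<epsilon>"
        using \<open>r \<le> R v\<close> by (intro R(2)) (auto intro: order_less_le_trans)
      then show ?case by (intro ennreal_leI) auto
    qed
  qed
  have "ennreal (max 0 (pair_cost x - \<epsilon>)) + ennreal (max 0 (pair_cost x' - \<epsilon>))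
      \<le> ennreal (pair_cost y + \<epsilon>) + ennreal (pair_cost y' + \<epsilon>)"
    using order_trans[OF add_mono[OF lower[OF x r(2)] lower[OF x' r(3)]]
        order_trans[OF le add_mono[OF upper[OF pq(1,3,5) r(4)] upper[OF pq(2,4,6) r(5)]]]] .
  moreover have "0 \<le> pair_cost y + \<epsilon>" "0 \<le> pair_cost y' + \<epsilon>"
    using \<open>\<epsilon> > 0\<close> pair_cost_nonneg[of y] pair_cost_nonneg[of y'] by linarith+
  ultimately have "ennreal (max 0 (pair_cost x - \<epsilon>) + max 0 (pair_cost x' - \<epsilon>))
      \<le> ennreal (pair_cost y + \<epsilon> + (pair_cost y' + \<epsilon>))"
    by (subst (1 2) ennreal_plus) simp_all
  then have "max 0 (pair_cost x - \<epsilon>) + max 0 (pair_cost x' - \<epsilon>) \<le> pair_cost y + \<epsilon> + (pair_cost y' + \<epsilon>)"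
    using \<open>0 \<le> pair_cost y + \<epsilon>\<close> \<open>0 \<le> pair_cost y' + \<epsilon>\<close> by (subst (asm) ennreal_le_iff) auto
  then show "pair_cost x + pair_cost x' \<le> pair_cost y + pair_cost y' + e"
    unfolding \<epsilon>_def by linarith
qed

end

subsection \<open>Structure of optimal plans\<close>

text \<open>Peeling off \<open>B \<inter> A j\<close> for one index at a time turns an overlapping
  cover into disjoint pieces. This passes from "every point has a suitable index" to a statement
  about measures.\<close>

lemma finite_cover_induct [consumes 3, case_names piece union]:
  assumes "finite J" "B \<in> sets M" "B \<subseteq> (\<Union>j\<in>J. A j)"
    and piece: "\<And>j B. j \<in> J \<Longrightarrow> B \<in> sets M \<Longrightarrow> B \<subseteq> A j \<Longrightarrow> P B"
    and union: "\<And>B C. B \<in> sets M \<Longrightarrow> C \<in> sets M \<Longrightarrow> B \<inter> C = {} \<Longrightarrow> P B \<Longrightarrow> P C \<Longrightarrow> P (B \<union> C)"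
    and empty: "P {}" and A: "\<And>j. j \<in> J \<Longrightarrow> A j \<in> sets M"
  shows "P B"
  using assms(1-3) piece A
proof (induction J arbitrary: B rule: finite_induct)
  case (insert j J)
  have meas: "B \<inter> A j \<in> sets M" "B - A j \<in> sets M"
    using insert.prems(1) insert.prems(4)[of j] by auto
  have "P (B \<inter> A j)"
    by (rule insert.prems(3)[of j]) (use meas in auto)
  moreover have "P (B - A j)"
  proof (rule insert.IH)
    show "B - A j \<subseteq> (\<Union>j\<in>J. A j)" using insert.prems(2) by blast
    show "P C" if "i \<in> J" "C \<in> sets M" "C \<subseteq> A i" for i C
      using insert.prems(3)[of i] that by blast
    show "A i \<in> sets M" if "i \<in> J" for i using insert.prems(4) that by blast
  qed (rule meas)
  ultimately have "P ((B \<inter> A j) \<union> (B - A j))" by (intro union meas) auto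
  then show ?case by (simp add: Int_Diff_Un)
qed (use empty in simp)

text \<open>Where g_j attains the minimum, \<mu>_j and the meet coincide, and these regions cover
  the space. Thus the meet is the greatest lower bound of the \<mu>_j.\<close>

lemma emeasure_le_meet_measure:
  fixes g :: "'k::finite \<Rightarrow> real ^ 'n \<Rightarrow> ennreal"
  assumes g[measurable]: "\<And>j. g j \<in> borel_measurable borel"
    and s: "sets \<eta> = sets borel"
    and le: "\<And>j E. E \<in> sets borel \<Longrightarrow> emeasure \<eta> E \<le> emeasure (density lborel (g j)) E"
    and E: "E \<in> sets borel"
  shows "emeasure \<eta> E \<le> emeasure (meet_measure g) E"
proof -
  define gm where "gm y = Min (range (\<lambda>j. g j y))" for y
  have gm[measurable]: "gm \<in> borel_measurable borel"
    unfolding gm_def by (simp add: borel_measurable_Min)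
  have meet: "meet_measure g = density lborel gm" by (simp add: meet_measure_def gm_def[abs_def])
  define A where "A j = {y. g j y = gm y}" for j
  have A: "A j \<in> sets borel" for j
  proof -
    have "{y \<in> space borel. g j y = gm y} \<in> sets borel" by measurable
    then show ?thesis by (simp add: A_def)
  qed
  have cover: "E \<subseteq> (\<Union>j\<in>UNIV. A j)"
  proof
    fix y
    have "gm y \<in> range (\<lambda>j. g j y)" unfolding gm_def by (rule Min_in) auto
    then show "y \<in> (\<Union>j\<in>UNIV. A j)" by (auto simp: A_def)
  qed
  show ?thesis
    unfolding meet
  proof (rule finite_cover_induct[OF finite_class.finite_UNIV E cover])
    fix j B assume B: "B \<in> sets borel" "B \<subseteq> A j"
    have "emeasure \<eta> B \<le> emeasure (density lborel (g j)) B" using B by (intro le)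
    also have "\<dots> = (\<integral>\<^sup>+ y. g j y * indicator B y \<partial>lborel)" using B by (simp add: emeasure_density)
    also have "\<dots> = (\<integral>\<^sup>+ y. gm y * indicator B y \<partial>lborel)"
      using B(2) by (intro nn_integral_cong) (auto simp: A_def split: split_indicator)
    also have "\<dots> = emeasure (density lborel gm) B" using B by (simp add: emeasure_density)
    finally show "emeasure \<eta> B \<le> emeasure (density lborel gm) B" .
  next
    fix B C assume *: "B \<in> sets borel" "C \<in> sets borel" "B \<inter> C = {}"
      "emeasure \<eta> B \<le> emeasure (density lborel gm) B" "emeasure \<eta> C \<le> emeasure (density lborel gm) C"
    then show "emeasure \<eta> (B \<union> C) \<le> emeasure (density lborel gm) (B \<union> C)"
      by (simp add: plus_emeasure[symmetric] s add_mono)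
  qed (auto simp: A)
qed

lemma power2_norm_add: "(norm (a + b))\<^sup>2 = (norm a)\<^sup>2 + 2 * (a \<bullet> b) + (norm b)\<^sup>2"
  for a b :: "'a::real_inner"
  by (simp add: power2_norm_eq_inner inner_add_left inner_add_right inner_commute)

lemma pair_cost_update:
  fixes x :: "(real ^ 'n) ^ 'k"
  shows "pair_cost (\<chi> i. x $ i + (if i = j then d else 0)) = pair_cost x
    + 2 * real CARD('k) * (2 * (x $ j \<bullet> d) + (norm d)\<^sup>2)
    - 2 * (2 * ((\<Sum>i\<in>UNIV. x $ i) \<bullet> d) + (norm d)\<^sup>2)"
proof -
  have "(\<Sum>i\<in>UNIV. (norm (x $ i + (if i = j then d else 0)))\<^sup>2)
      = (\<Sum>i\<in>UNIV. (norm (x $ i))\<^sup>2 + (if i = j then 2 * (x $ i \<bullet> d) + (norm d)\<^sup>2 else 0))"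
    by (intro sum.cong) (auto simp: power2_norm_add)
  also have "\<dots> = (\<Sum>i\<in>UNIV. (norm (x $ i))\<^sup>2) + (2 * (x $ j \<bullet> d) + (norm d)\<^sup>2)"
    by (simp add: sum.distrib)
  finally have 1: "(\<Sum>i\<in>UNIV. (norm (x $ i + (if i = j then d else 0)))\<^sup>2)
      = (\<Sum>i\<in>UNIV. (norm (x $ i))\<^sup>2) + (2 * (x $ j \<bullet> d) + (norm d)\<^sup>2)" .
  have 2: "(\<Sum>i\<in>UNIV. x $ i + (if i = j then d else 0)) = (\<Sum>i\<in>UNIV. x $ i) + d"
    by (simp add: sum.distrib)
  show ?thesis
    unfolding pair_cost_expand vec_lambda_beta 1 2 power2_norm_add[of _ d] by (simp add: algebra_simps)
qed

context partial_transport
begin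

text \<open>The feasible set is convex and the cost is linear.\<close>

lemma optimal_average:
  assumes opt: "optimal \<sigma>1" "optimal \<sigma>2"
  obtains \<sigma> where "optimal \<sigma>" "\<And>A. A \<in> sets borel \<Longrightarrow> emeasure \<sigma> A = (emeasure \<sigma>1 A + emeasure \<sigma>2 A) / 2"
proof -
  define \<sigma> where "\<sigma> = scale_measure (1 / 2) (add_measure \<sigma>1 \<sigma>2)"
  have feas: "feasible \<sigma>1" "feasible \<sigma>2" using opt by (auto simp: optimal_iff)
  then have s: "sets \<sigma>1 = sets borel" "sets \<sigma>2 = sets borel" by (auto simp: feasible_iff)
  have em: "emeasure \<sigma> A = (emeasure \<sigma>1 A + emeasure \<sigma>2 A) / 2" if "A \<in> sets borel" for A
    using that s by (simp add: \<sigma>_def emeasure_add_measure ennreal_half_times)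
  have half_le: "(a + b) / 2 \<le> c" if "a \<le> c" "b \<le> c" for a b c :: ennreal
    using add_mono[OF divide_right_mono_ennreal[OF that(1), of 2] divide_right_mono_ennreal[OF that(2), of 2]]
    by (simp add: ennreal_halves add_divide_distrib_ennreal)
  have "feasible \<sigma>"
    unfolding feasible_iff
  proof (intro conjI allI ballI)
    show "sets \<sigma> = sets borel" by (simp add: \<sigma>_def s)
    show "emeasure \<sigma> UNIV = ennreal m"
      using feas by (simp add: em feasible_iff add_divide_distrib_ennreal ennreal_halves)
    fix j and E :: "(real ^ 'n) set" assume E: "E \<in> sets borel"
    then have "{x :: (real ^ 'n) ^ 'k. x $ j \<in> E} \<in> sets borel"
      using measurable_sets[OF borel_measurable_vec_nth E, of j] by (simp add: vimage_def)
    then show "emeasure \<sigma> {x. x $ j \<in> E} \<le> emeasure (\<mu> j) E"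
      using feas E by (simp add: em feasible_iff half_le)
  qed
  moreover have "transport_cost \<sigma> \<le> transport_cost \<sigma>1"
  proof -
    have pc: "(\<lambda>x. ennreal (pair_cost x)) \<in> borel_measurable \<sigma>1"
      by (simp cong: measurable_cong_sets add: s)
    then have "(\<lambda>x. ennreal (pair_cost x)) \<in> borel_measurable (add_measure \<sigma>1 \<sigma>2)"
      by (simp cong: measurable_cong_sets)
    then have "transport_cost \<sigma> = (transport_cost \<sigma>1 + transport_cost \<sigma>2) / 2"
      unfolding transport_cost_eq \<sigma>_def
      by (simp add: nn_integral_scale_measure nn_integral_add_measure pc s ennreal_half_times)
    then show ?thesis using opt feas by (simp add: optimal_iff half_le)
  qed
  ultimately have "optimal \<sigma>" using opt by (auto simp: optimal_iff intro: order_trans)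
  then show ?thesis using that em by blast
qed

text \<open>The terms with \<open>CARD('k)\<close> cancel because a swap keeps the total of the
  squared norms. What remains is that |S + d|^2 + |S' - d|^2 is at most |S|^2 + |S'|^2.\<close>

lemma optimal_swap:
  assumes opt: "optimal \<sigma>" and x: "x \<in> measure_support \<sigma>" "x' \<in> measure_support \<sigma>"
  shows "(norm (x' $ j - x $ j))\<^sup>2 \<le> (x' $ j - x $ j) \<bullet> ((\<Sum>i\<in>UNIV. x' $ i) - (\<Sum>i\<in>UNIV. x $ i))"
proof -
  define d where "d = x' $ j - x $ j"
  define y where "y = (\<chi> i. x $ i + (if i = j then d else 0))"
  define y' where "y' = (\<chi> i. x' $ i + (if i = j then - d else 0))"
  have "pair_cost x + pair_cost x' \<le> pair_cost y + pair_cost y'"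
    by (rule pair_cost_exchange[OF opt x]) (auto simp: y_def y'_def d_def)
  then have "0 \<le> 4 * real CARD('k) * (x $ j \<bullet> d - x' $ j \<bullet> d + (norm d)\<^sup>2)
      - 4 * ((\<Sum>i\<in>UNIV. x $ i) \<bullet> d - (\<Sum>i\<in>UNIV. x' $ i) \<bullet> d + (norm d)\<^sup>2)"
    unfolding y_def y'_def pair_cost_update by (simp add: algebra_simps)
  moreover have "x $ j \<bullet> d - x' $ j \<bullet> d + (norm d)\<^sup>2 = 0"
    unfolding d_def power2_norm_eq_inner by (simp add: inner_diff_left)
  ultimately have "(norm d)\<^sup>2 \<le> (\<Sum>i\<in>UNIV. x' $ i) \<bullet> d - (\<Sum>i\<in>UNIV. x $ i) \<bullet> d" by simp
  then show ?thesis unfolding d_def[symmetric] by (simp add: inner_diff_right inner_commute)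
qed

text \<open>With x as its own partner only one copy moves. The vector S x - N x_j, if nonzero, is
  thus an exterior-ball direction for the support of the residual at x_j. The constant is
  deliberately crude: only its independence of x and z matters.\<close>

lemma optimal_replace:
  assumes opt: "optimal \<sigma>" and x: "x \<in> measure_support \<sigma>"
    and z: "z \<in> measure_support (residual \<sigma> j)"
  shows "(z - x $ j) \<bullet> ((\<Sum>i\<in>UNIV. x $ i) - real CARD('k) *\<^sub>R x $ j) \<le> real CARD('k) * (norm (z - x $ j))\<^sup>2"
proof -
  define d where "d = z - x $ j"
  define y where "y = (\<chi> i. x $ i + (if i = j then d else 0))"
  have "pair_cost x + pair_cost x \<le> pair_cost y + pair_cost x"
    by (rule pair_cost_exchange[OF opt x x]) (auto simp: y_def d_def z)
  then have "0 \<le> real CARD('k) * (2 * (x $ j \<bullet> d) + (norm d)\<^sup>2) - (2 * ((\<Sum>i\<in>UNIV. x $ i) \<bullet> d) + (norm d)\<^sup>2)"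
    unfolding y_def pair_cost_update by simp
  then have "2 * (d \<bullet> ((\<Sum>i\<in>UNIV. x $ i) - real CARD('k) *\<^sub>R x $ j)) \<le> real CARD('k) * (norm d)\<^sup>2 - (norm d)\<^sup>2"
    by (simp add: inner_diff_right inner_commute algebra_simps)
  moreover have "0 \<le> real CARD('k) * (norm d)\<^sup>2" "0 \<le> (norm d)\<^sup>2" by simp_all
  ultimately show ?thesis unfolding d_def[symmetric] by linarith
qed

text \<open>Absolute continuity enters here. \<open>Q\<close> need not be Borel, so it is first
  enclosed in a measurable null set of \<mu>_j.\<close>

lemma AE_marginal_negligible:
  assumes feas: "feasible \<sigma>" and Q: "negligible Q"
  shows "AE x in \<sigma>. x $ j \<notin> Q"
proof -
  have "AE y in lebesgue. y \<notin> Q" using Q by (intro AE_not_in) (simp add: negligible_iff_null_sets)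
  then have "AE y in lborel. y \<notin> Q" by (simp add: AE_completion_iff)
  then have "AE y in \<mu> j. y \<notin> Q"
    by (rule absolutely_continuous_AE[OF _ ac_\<mu>, rotated]) (simp add: sets_\<mu>)
  then obtain N where N: "{y \<in> space (\<mu> j). \<not> y \<notin> Q} \<subseteq> N" "emeasure (\<mu> j) N = 0" "N \<in> sets (\<mu> j)"
    by (rule AE_E)
  have N': "N \<in> sets borel" using N(3) sets_\<mu> by simp
  have s: "sets \<sigma> = sets borel" using feas by (simp add: feasible_iff)
  have "{x :: (real ^ 'n) ^ 'k. x $ j \<in> N} \<in> sets \<sigma>"
    unfolding s using measurable_sets[OF borel_measurable_vec_nth N', of j] by (simp add: vimage_def)
  moreover have "emeasure \<sigma> {x. x $ j \<in> N} = 0"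
    using feas N(2) N' by (auto simp: feasible_iff dest!: spec[of _ j] bspec[of _ _ N])
  ultimately have "{x. x $ j \<in> N} \<in> null_sets \<sigma>" by blast
  moreover have "Q \<subseteq> N" using N(1) sets_eq_imp_space_eq[OF sets_\<mu>] by auto
  ultimately show ?thesis by (intro AE_I') auto
qed

text \<open>The first clause compares with the whole support, so that of two points sharing a
  coordinate only one has to be regular.\<close>

definition regular_points :: "((real ^ 'n) ^ 'k) measure \<Rightarrow> ((real ^ 'n) ^ 'k) set" where
  "regular_points \<sigma> = {x \<in> measure_support \<sigma>. \<forall>j.
    (\<forall>x'\<in>measure_support \<sigma>. x' $ j = x $ j \<longrightarrow> x' = x) \<and>
    (x $ j \<in> measure_support (residual \<sigma> j) \<longrightarrow> (\<Sum>i\<in>UNIV. x $ i) = real CARD('k) *\<^sub>R x $ j)}"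

lemma AE_regular_points:
  assumes opt: "optimal \<sigma>"
  shows "AE x in \<sigma>. x \<in> regular_points \<sigma>"
proof -
  have feas: "feasible \<sigma>" using opt by (simp add: optimal_iff)
  define S where "S x = (\<Sum>i\<in>UNIV. x $ i)" for x :: "(real ^ 'n) ^ 'k"
  \<comment> \<open>The possibly multivalued relation from x_j to S x; \<open>Q1 j\<close> collects
    the points where it has two values.\<close>
  define M where "M j = (\<lambda>x. (x $ j, S x)) ` measure_support \<sigma>" for j
  define Z where "Z j = measure_support (residual \<sigma> j)" for j
  define Q1 where "Q1 j = {p. \<exists>s t. (p, s) \<in> M j \<and> (p, t) \<in> M j \<and> s \<noteq> t}" for j
  define Q2 where "Q2 j = {p \<in> Z j. \<exists>w. w \<noteq> 0 \<and> (\<forall>z\<in>Z j. (z - p) \<bullet> w \<le> real CARD('k) * (norm (z - p))\<^sup>2)}" for j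
  have "negligible (Q1 j)" for j
    unfolding Q1_def
  proof (rule negligible_monotone_multivalued)
    fix p s q t assume "(p, s) \<in> M j" "(q, t) \<in> M j"
    then obtain x x' where "x \<in> measure_support \<sigma>" "x' \<in> measure_support \<sigma>"
      and pq: "p = x' $ j" "s = S x'" "q = x $ j" "t = S x"
      by (auto simp: M_def)
    then have "(norm (p - q))\<^sup>2 \<le> (p - q) \<bullet> (s - t)"
      unfolding pq S_def by (intro optimal_swap[OF opt])
    then show "0 \<le> (p - q) \<bullet> (s - t)" using zero_le_power2[of "norm (p - q)"] by linarith
  qed
  then have 1: "AE x in \<sigma>. \<forall>j. x $ j \<notin> Q1 j"
    by (simp add: AE_all_countable AE_marginal_negligible[OF feas])
  have "negligible (Q2 j)" for j
    unfolding Q2_def by (rule negligible_exterior_ball_points)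
  then have 2: "AE x in \<sigma>. \<forall>j. x $ j \<notin> Q2 j"
    by (simp add: AE_all_countable AE_marginal_negligible[OF feas])
  have 3: "AE x in \<sigma>. x \<in> measure_support \<sigma>"
    using feas by (intro AE_measure_support) (simp add: feasible_iff)
  from 1 2 3 show ?thesis
  proof eventually_elim
    case (elim x)
    have "x' = x" if x': "x' \<in> measure_support \<sigma>" "x' $ j = x $ j" for x' j
    proof -
      have "(x $ j, S x) \<in> M j" "(x $ j, S x') \<in> M j"
        using elim(3) x' unfolding M_def by (auto intro: image_eqI[of _ _ x'])
      then have "S x' = S x" using elim(1) unfolding Q1_def by blast
      then have "(norm (x' $ i - x $ i))\<^sup>2 \<le> 0" for i
        using optimal_swap[OF opt elim(3) x'(1), of i] by (simp add: S_def)
      then show ?thesis by (simp add: vec_eq_iff)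
    qed
    moreover have "S x = real CARD('k) *\<^sub>R x $ j" if "x $ j \<in> Z j" for j
    proof (rule ccontr)
      assume "S x \<noteq> real CARD('k) *\<^sub>R x $ j"
      then have "S x - real CARD('k) *\<^sub>R x $ j \<noteq> 0" by simp
      moreover have "\<forall>z\<in>Z j. (z - x $ j) \<bullet> (S x - real CARD('k) *\<^sub>R x $ j) \<le> real CARD('k) * (norm (z - x $ j))\<^sup>2"
        unfolding S_def Z_def using optimal_replace[OF opt elim(3)] by blast
      ultimately have "x $ j \<in> Q2 j" unfolding Q2_def using that by blast
      then show False using elim(2) by blast
    qed
    ultimately show ?case
      using elim(3) by (simp add: regular_points_def S_def Z_def)
  qed
qed

end

subsection \<open>Uniqueness\<close>

lemma ennreal_average_eqD:
  fixes a b c :: ennreal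
  assumes "a \<le> c" "b \<le> c" "(a + b) / 2 = c" "c \<noteq> \<top>"
  shows "a = c" "b = c"
proof -
  have *: "a + b = c + c" using ennreal_halves[of "a + b"] assms(3) by simp
  obtain c' where c: "0 \<le> c'" "c = ennreal c'" using assms(4) by (cases c) auto
  obtain a' where a: "0 \<le> a'" "a = ennreal a'" using assms(1,4) by (cases a) (auto simp: top_unique)
  obtain b' where b: "0 \<le> b'" "b = ennreal b'" using assms(2,4) by (cases b) (auto simp: top_unique)
  have "a' \<le> c'" "b' \<le> c'" using assms(1,2) a b c by auto
  moreover have "a' + b' = c' + c'"
    using * a b c by (simp add: ennreal_plus[symmetric] del: ennreal_plus)
  ultimately show "a = c" "b = c" using a b c by auto
qed

context partial_transport
begin

text \<open>All marginals of a diagonal plan are one measure \<eta>, which lies below every \<mu>_j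
  and so below \<nu> by \<open>glb\<close>. As \<eta> has mass m, at least that of \<nu>, the two
  agree, and \<eta> determines the plan.\<close>

lemma diagonal_plan_eq:
  assumes feas: "feasible \<tau>"
    and diag: "AE x in \<tau>. \<forall>j k. x $ j = x $ k"
    and s: "sets \<nu> = sets borel" and mass: "emeasure \<nu> UNIV \<le> ennreal m"
    and glb: "\<And>\<eta> E. sets \<eta> = sets borel \<Longrightarrow>
      (\<And>j E. E \<in> sets borel \<Longrightarrow> emeasure \<eta> E \<le> emeasure (\<mu> j) E) \<Longrightarrow>
      E \<in> sets borel \<Longrightarrow> emeasure \<eta> E \<le> emeasure \<nu> E"
    and A: "A \<in> sets borel"
  shows "emeasure \<tau> A = emeasure \<nu> {y. (\<chi> j. y) \<in> A}"
proof -
  have s\<tau>: "sets \<tau> = sets borel" using feas by (simp add: feasible_iff)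
  have coord: "{x :: (real ^ 'n) ^ 'k. x $ j \<in> E} \<in> sets borel" if "E \<in> sets borel" for j E
    using measurable_sets[OF borel_measurable_vec_nth that, of j] by (simp add: vimage_def)
  obtain j0 :: 'k where True by blast
  define \<eta> where "\<eta> = marginal \<tau> j0"
  have \<eta>: "emeasure \<eta> E = emeasure \<tau> {x. x $ j0 \<in> E}" if "E \<in> sets borel" for E
    unfolding \<eta>_def by (rule emeasure_marginal[OF s\<tau> that])
  have s\<eta>: "sets \<eta> = sets borel" by (simp add: \<eta>_def)
  have le: "emeasure \<eta> E \<le> emeasure \<nu> E" if E: "E \<in> sets borel" for E
  proof (rule glb[OF s\<eta> _ E])
    fix j and F :: "(real ^ 'n) set" assume F: "F \<in> sets borel"
    have "emeasure \<eta> F = emeasure \<tau> {x. x $ j \<in> F}"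
      unfolding \<eta>[OF F]
    proof (rule emeasure_eq_AE)
      show "AE x in \<tau>. x \<in> {x. x $ j0 \<in> F} \<longleftrightarrow> x \<in> {x. x $ j \<in> F}"
        using diag
      proof eventually_elim
        case (elim x)
        then have "x $ j0 = x $ j" by blast
        then show ?case by simp
      qed
    qed (use coord[OF F] in \<open>auto simp: s\<tau>\<close>)
    then show "emeasure \<eta> F \<le> emeasure (\<mu> j) F" using feas F by (simp add: feasible_iff)
  qed
  have eq: "emeasure \<eta> E = emeasure \<nu> E" if E: "E \<in> sets borel" for E
  \<comment> \<open>\<eta> cannot be smaller on \<open>E\<close>, as it would have to make up for
    this on the complement; the finite value of \<nu> there cancels.\<close>
  proof -
    have "emeasure \<eta> E + emeasure \<eta> (- E) = emeasure \<eta> (E \<union> - E)"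
      using E by (intro plus_emeasure) (auto simp: s\<eta>)
    moreover have "emeasure \<nu> E + emeasure \<nu> (- E) = emeasure \<nu> (E \<union> - E)"
      using E by (intro plus_emeasure) (auto simp: s)
    moreover have "emeasure \<eta> UNIV = ennreal m" using feas by (simp add: \<eta> feasible_iff)
    ultimately have sum: "emeasure \<nu> E + emeasure \<nu> (- E) \<le> emeasure \<eta> E + emeasure \<eta> (- E)"
      using mass by simp
    also have "\<dots> \<le> emeasure \<eta> E + emeasure \<nu> (- E)"
      using E by (intro add_left_mono le) auto
    finally have "emeasure \<nu> (- E) + emeasure \<nu> E \<le> emeasure \<nu> (- E) + emeasure \<eta> E"
      by (simp add: add.commute)
    moreover have "emeasure \<nu> (- E) \<le> emeasure \<nu> UNIV"
      using E by (intro emeasure_mono) (auto simp: s)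
    then have "emeasure \<nu> (- E) \<noteq> \<top>" using mass by (auto simp: top_unique)
    ultimately have "emeasure \<nu> E \<le> emeasure \<eta> E" by (simp add: ennreal_add_left_cancel_le)
    then show ?thesis using le[OF E] by simp
  qed
  have "continuous_on UNIV (\<lambda>y :: real ^ 'n. (\<chi> j. y) :: (real ^ 'n) ^ 'k)"
    by (intro continuous_intros)
  then have "(\<lambda>y :: real ^ 'n. (\<chi> j. y) :: (real ^ 'n) ^ 'k) \<in> borel_measurable borel"
    by (rule borel_measurable_continuous_onI)
  from measurable_sets[OF this A] have B: "{y. (\<chi> j. y) \<in> A} \<in> sets borel"
    by (simp add: vimage_def)
  have "emeasure \<tau> A = emeasure \<tau> {x. x $ j0 \<in> {y. (\<chi> j. y) \<in> A}}"
  proof (rule emeasure_eq_AE)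
    show "AE x in \<tau>. x \<in> A \<longleftrightarrow> x \<in> {x. x $ j0 \<in> {y. (\<chi> j. y) \<in> A}}"
      using diag
    proof eventually_elim
      case (elim x)
      then have "(\<chi> j. x $ j0) = x" by (simp add: vec_eq_iff)
      then show ?case by simp
    qed
  qed (use A coord[OF B] in \<open>auto simp: s\<tau>\<close>)
  also have "\<dots> = emeasure \<nu> {y. (\<chi> j. y) \<in> A}" using \<eta>[OF B] eq[OF B] by simp
  finally show ?thesis .
qed

lemma optimal_unique:
  assumes opt: "optimal \<sigma>1" "optimal \<sigma>2"
    and \<nu>: "sets \<nu> = sets borel" "emeasure \<nu> UNIV \<le> ennreal m"
    and glb: "\<And>\<eta> E. sets \<eta> = sets borel \<Longrightarrow>
      (\<And>j E. E \<in> sets borel \<Longrightarrow> emeasure \<eta> E \<le> emeasure (\<mu> j) E) \<Longrightarrow>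
      E \<in> sets borel \<Longrightarrow> emeasure \<eta> E \<le> emeasure \<nu> E"
  shows "\<sigma>1 = \<sigma>2"
proof -
  obtain \<sigma> where \<sigma>: "optimal \<sigma>"
    and avg: "\<And>A. A \<in> sets borel \<Longrightarrow> emeasure \<sigma> A = (emeasure \<sigma>1 A + emeasure \<sigma>2 A) / 2"
    using optimal_average[OF opt] by blast
  have feas: "feasible \<sigma>" "feasible \<sigma>1" "feasible \<sigma>2" using \<sigma> opt by (auto simp: optimal_iff)
  then have s: "sets \<sigma> = sets borel" "sets \<sigma>1 = sets borel" "sets \<sigma>2 = sets borel"
    by (auto simp: feasible_iff)
  have coord: "{x :: (real ^ 'n) ^ 'k. x $ j \<in> E} \<in> sets borel" if "E \<in> sets borel" for j E
    using measurable_sets[OF borel_measurable_vec_nth that, of j] by (simp add: vimage_def)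
  \<comment> \<open>A null set of the average is null for both plans, so everything known almost
    surely for the average passes to them.\<close>
  have "absolutely_continuous \<sigma> \<sigma>1" "absolutely_continuous \<sigma> \<sigma>2"
    by (auto simp: absolutely_continuous_def null_sets_def s avg ennreal_divide_eq_0_iff)
  then have AE_transfer: "(AE x in \<sigma>1. P x) \<and> (AE x in \<sigma>2. P x)" if "AE x in \<sigma>. P x" for P
    using that s by (auto intro: absolutely_continuous_AE)
  define Z where "Z j = measure_support (residual \<sigma> j)" for j
  have closed_Z: "closed (Z j)" for j unfolding Z_def by (rule closed_measure_support) simp
  obtain N where N: "{x \<in> space \<sigma>. \<not> x \<in> regular_points \<sigma>} \<subseteq> N" "emeasure \<sigma> N = 0" "N \<in> sets \<sigma>"
    using AE_regular_points[OF \<sigma>] by (rule AE_E)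
  \<comment> \<open>A Borel set of full measure inside \<open>regular_points \<sigma>\<close>, whose
    own measurability is left open.\<close>
  define \<Gamma> where "\<Gamma> = - N"
  have \<Gamma>: "\<Gamma> \<in> sets borel" "\<Gamma> \<subseteq> regular_points \<sigma>"
    using N s(1) sets_eq_imp_space_eq[OF s(1)] by (auto simp: \<Gamma>_def)
  have AE_\<Gamma>: "AE x in \<sigma>. x \<in> \<Gamma>"
    using N(2,3) by (intro AE_I'[of N]) (auto simp: \<Gamma>_def null_sets_def)
  have AE_supp: "AE x in \<sigma>. x \<in> measure_support \<sigma>" using s(1) by (rule AE_measure_support)
  have eq_compact: "emeasure \<sigma>1 K = emeasure \<sigma>2 K"
    if K: "compact K" "K \<subseteq> \<Gamma>" and KZ: "\<And>x. x \<in> K \<Longrightarrow> x $ j \<notin> Z j" for K j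
  proof -
    define E where "E = (\<lambda>x. x $ j) ` K"
    have "compact E" unfolding E_def by (intro compact_continuous_image continuous_intros K)
    then have E: "E \<in> sets borel" by (rule borel_compact)
    have "AE y in residual \<sigma> j. y \<in> Z j"
      unfolding Z_def by (rule AE_measure_support) simp
    then have "AE y in residual \<sigma> j. \<not> y \<in> E"
      by eventually_elim (use KZ in \<open>auto simp: E_def\<close>)
    then have "emeasure (residual \<sigma> j) {y \<in> space (residual \<sigma> j). y \<in> E} = 0"
      by (rule emeasure_eq_0_AE)
    then have "emeasure (residual \<sigma> j) E = 0"
      using sets_eq_imp_space_eq[OF sets_residual, of \<sigma> j] by simp
    then have "(emeasure \<sigma>1 {x. x $ j \<in> E} + emeasure \<sigma>2 {x. x $ j \<in> E}) / 2 = emeasure (\<mu> j) E"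
      using emeasure_residual[OF feas(1) E, of j] emeasure_marginal[OF s(1) E, of j] avg[OF coord[OF E]]
      by simp
    then have "emeasure \<sigma>1 {x. x $ j \<in> E} = emeasure (\<mu> j) E" "emeasure \<sigma>2 {x. x $ j \<in> E} = emeasure (\<mu> j) E"
      using ennreal_average_eqD[of "emeasure \<sigma>1 {x. x $ j \<in> E}" "emeasure (\<mu> j) E" "emeasure \<sigma>2 {x. x $ j \<in> E}"]
        feas(2,3) E finite_measure.emeasure_finite[OF finite_\<mu>, of j E]
      by (auto simp: feasible_iff)
    moreover have "AE x in \<sigma>. x \<in> K \<longleftrightarrow> x \<in> {x. x $ j \<in> E}"
      using AE_supp
    proof eventually_elim
      case (elim x)
      have "x \<in> K" if xE: "x $ j \<in> E"
      proof -
        obtain k where k: "k \<in> K" "x $ j = k $ j" using xE by (auto simp: E_def)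
        then have "k \<in> regular_points \<sigma>" using K(2) \<Gamma>(2) by blast
        then have "x = k" using elim k(2) unfolding regular_points_def by blast
        then show ?thesis using k(1) by simp
      qed
      then show ?case by (auto simp: E_def)
    qed
    then have "emeasure \<sigma>1 K = emeasure \<sigma>1 {x. x $ j \<in> E}" "emeasure \<sigma>2 K = emeasure \<sigma>2 {x. x $ j \<in> E}"
      using AE_transfer coord[OF E] borel_compact[OF K(1)]
      by (auto intro!: emeasure_eq_AE simp: s)
    ultimately show ?thesis by simp
  qed
  show ?thesis
  proof (cases "\<forall>x\<in>\<Gamma>. \<exists>j. x $ j \<notin> Z j")
    case True
    show ?thesis
    proof (rule measure_eqI)
      fix B assume "B \<in> sets \<sigma>1"
      then have B: "B \<in> sets borel" by (simp add: s)
      define P where "P j = \<Gamma> \<inter> {x. x $ j \<in> - Z j}" for j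
      have P: "P j \<in> sets borel" for j
        unfolding P_def using closed_Z[of j] by (intro sets.Int \<Gamma>(1) coord) auto
      have B\<Gamma>: "B \<inter> \<Gamma> \<in> sets borel" using B \<Gamma>(1) by simp
      have cover: "B \<inter> \<Gamma> \<subseteq> (\<Union>j\<in>UNIV. P j)" using True by (auto simp: P_def)
      have "emeasure \<sigma>1 (B \<inter> \<Gamma>) = emeasure \<sigma>2 (B \<inter> \<Gamma>)"
      proof (rule finite_cover_induct[OF finite_class.finite_UNIV B\<Gamma> cover])
        fix j C assume C: "C \<in> sets borel" "C \<subseteq> P j"
        \<comment> \<open>Inner regularity extends the equality from compact sets to Borel
          pieces.\<close>
        have "emeasure \<tau> C = (SUP K\<in>{K. K \<subseteq> C \<and> compact K}. emeasure \<tau> K)" if "feasible \<tau>" for \<tau>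
          using feasible_finite[OF that] that C(1)
          by (intro inner_regular) (auto simp: feasible_iff finite_measure.emeasure_finite)
        then show "emeasure \<sigma>1 C = emeasure \<sigma>2 C"
          using feas(2,3) C(2) by (auto simp: P_def intro!: SUP_cong eq_compact[of _ j])
      qed (auto simp: P s plus_emeasure[symmetric])
      moreover have "emeasure \<sigma>1 B = emeasure \<sigma>1 (B \<inter> \<Gamma>)" "emeasure \<sigma>2 B = emeasure \<sigma>2 (B \<inter> \<Gamma>)"
        using AE_transfer[OF AE_\<Gamma>] B B\<Gamma> by (auto intro!: emeasure_eq_AE simp: s elim!: eventually_mono)
      ultimately show "emeasure \<sigma>1 B = emeasure \<sigma>2 B" by simp
    qed (simp add: s)
  next
    case False
    then obtain x0 where x0: "x0 \<in> \<Gamma>" "\<And>j. x0 $ j \<in> Z j" by blast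
    have reg: "x0 \<in> regular_points \<sigma>" using x0(1) \<Gamma>(2) by blast
    have "x0 $ j = x0 $ k" for j k
    proof -
      have "real CARD('k) *\<^sub>R x0 $ j = real CARD('k) *\<^sub>R x0 $ k"
        using reg x0(2) unfolding regular_points_def Z_def by (metis (mono_tags, lifting) mem_Collect_eq)
      then show ?thesis by simp
    qed
    then have "pair_cost x0 = 0" unfolding pair_cost_def by (intro sum.neutral) auto
    have "AE x in \<sigma>. \<forall>j k. x $ j = x $ k"
      using AE_supp
    proof eventually_elim
      case (elim x)
      have "pair_cost x + pair_cost x \<le> pair_cost x0 + pair_cost x"
        by (rule pair_cost_exchange[OF \<sigma> elim elim]) (use x0(2) in \<open>auto simp: Z_def\<close>)
      then have "pair_cost x = 0" using \<open>pair_cost x0 = 0\<close> pair_cost_nonneg[of x] by simp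
      then have "\<forall>p\<in>{(j, k). j \<noteq> k}. (case p of (j, k) \<Rightarrow> (norm (x $ j - x $ k))\<^sup>2) = 0"
        unfolding pair_cost_def by (subst (asm) sum_nonneg_eq_0_iff) auto
      then have "x $ j = x $ k" if "j \<noteq> k" for j k using that by auto
      then show ?case by metis
    qed
    from AE_transfer[OF this] show ?thesis
    proof (intro measure_eqI)
      assume diag: "(AE x in \<sigma>1. \<forall>j k. x $ j = x $ k) \<and> (AE x in \<sigma>2. \<forall>j k. x $ j = x $ k)"
      fix A assume "A \<in> sets \<sigma>1"
      then have A: "A \<in> sets borel" by (simp add: s)
      have "emeasure \<sigma>1 A = emeasure \<nu> {y. (\<chi> j. y) \<in> A}"
        by (rule diagonal_plan_eq[OF feas(2) conjunct1[OF diag] \<nu> _ A]) (rule glb; assumption)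
      moreover have "emeasure \<sigma>2 A = emeasure \<nu> {y. (\<chi> j. y) \<in> A}"
        by (rule diagonal_plan_eq[OF feas(3) conjunct2[OF diag] \<nu> _ A]) (rule glb; assumption)
      ultimately show "emeasure \<sigma>1 A = emeasure \<sigma>2 A" by simp
    qed (simp add: s)
  qed
qed

end

theorem corollary1p3:
  fixes \<mu> :: "'k::finite \<Rightarrow> (real ^ 'n) measure"
    and g :: "'k \<Rightarrow> real ^ 'n \<Rightarrow> ennreal"
    and m :: real
  assumes "\<And>j. absolutely_continuous lborel (\<mu> j)"
    and "\<And>j. finite_measure (\<mu> j)"
    and "\<And>j. finite_second_moment (\<mu> j)"
    and "\<And>j. g j \<in> borel_measurable borel"
    and "\<And>j. \<mu> j = density lborel (g j)"
    and "0 \<le> m"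
    and "total_mass (meet_measure g) \<le> ennreal m"
    and "ennreal m \<le> Min (range (\<lambda>j. total_mass (\<mu> j)))"
  shows "\<exists>!\<sigma>. is_arg_min transport_cost (\<lambda>\<sigma>. \<sigma> \<in> partial_plans \<mu> \<and> total_mass \<sigma> = ennreal m) \<sigma>"
proof -
  have sets_\<mu>: "sets (\<mu> j) = sets borel" for j by (simp add: assms(5))
  interpret partial_transport \<mu> m
    by (rule partial_transport.intro) (rule sets_\<mu> assms(1-3))+
  have "ennreal m \<le> emeasure (\<mu> j) UNIV" for j
  proof -
    have "ennreal m \<le> total_mass (\<mu> j)" using assms(8) by auto
    then show ?thesis using sets_eq_imp_space_eq[OF sets_\<mu>, of j] by (simp add: total_mass_def)
  qed
  then obtain \<sigma> where "optimal \<sigma>" using optimal_exists assms(6) by blast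
  moreover have "\<sigma>1 = \<sigma>2" if "optimal \<sigma>1" "optimal \<sigma>2" for \<sigma>1 \<sigma>2
  proof (rule optimal_unique[OF that, where \<nu> = "meet_measure g"])
    show "sets (meet_measure g) = sets borel" by (simp add: meet_measure_def)
    show "emeasure (meet_measure g) UNIV \<le> ennreal m"
      using assms(7) by (simp add: total_mass_def meet_measure_def)
    fix \<eta> :: "(real ^ 'n) measure" and E :: "(real ^ 'n) set"
    assume "sets \<eta> = sets borel" "E \<in> sets borel"
      and "\<And>j E. E \<in> sets borel \<Longrightarrow> emeasure \<eta> E \<le> emeasure (\<mu> j) E"
    then show "emeasure \<eta> E \<le> emeasure (meet_measure g) E"
      by (intro emeasure_le_meet_measure assms(4)) (simp_all add: assms(5))
  qed
  ultimately have "\<exists>!\<sigma>. optimal \<sigma>" by blast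
  then show ?thesis unfolding optimal_def feasible_def[abs_def] .
qed

end
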